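(* Let $V:\Omega\times\mathbb R^k\to\mathbb R$ be jointly measurable (w.r.t. $\mathcal F\otimes\mathcal B(\mathbb R^k)$) and, for $P$-a.e. $\omega\in\Omega$, let $V(\omega,\cdot)$ be convex. Assume that there exists $C>0$ such that $$\frac1C|F|^p-C\le V(\omega,F)\le C(|F|^p+1)$$ for $P$-a.e. $\omega\in\Omega$ and all $F\in\mathbb R^k$. Let $O,O^{+\varepsilon}\subset\mathbb R^d$ be bounded domains with Lipschitz boundaries satisfying $O\subset O^{+\varepsilon}\subset\{x\in\mathbb R^d:\operatorname{dist}(x,O)\le C\varepsilon\}$ for some $C>0$ (independent of $\varepsilon$). (i) If $u_\varepsilon\in L^p(\Omega\times\varepsilon\mathbb Z^d)^k$ and $u_\varepsilon\overset{2}{\rightharpoonup}U$ in $L^p(\Omega\times\mathbb R^d)^k$, then $$\liminf_{\varepsilon\to0}\Big\langle\int_{O^{+\varepsilon}\cap\varepsilon\mathbb Z^d}V(T_{\frac x\varepsilon}\omega,u_\varepsilon(\omega,x))\,dm_\varepsilon(x)\Big\rangle\ge\Big\langle\int_OV(\omega,U(\omega,x))\,dx\Big\rangle .$$ (ii) If $u_\varepsilon\in L^p(\Omega\times\varepsilon\mathbb Z^d)^k$ and $u_\varepsilon\overset{2}{\to}U$ in $L^p(\Omega\times\mathbb R^d)^k$, then $$\lim_{\varepsilon\to0}\Big\langle\int_{O^{+\varepsilon}\cap\varepsilon\mathbb Z^d}V(T_{\frac x\varepsilon}\omega,u_\varepsilon(\omega,x))\,dm_\varepsilon(x)\Big\rangle=\Big\langle\int_OV(\omega,U(\omega,x))\,dx\Big\rangle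 .$$
   Context: $p\in(1,\infty)$. $(\Omega,\mathcal F,P)$ is a probability space which is a separable measure space, $\langle\cdot\rangle$ denotes expectation, and $(T_x)_{x\in\mathbb Z^d}$ is a measure preserving dynamical system: each $T_x:\Omega\to\Omega$ is measurable, $T_0=\mathrm{Id}$, $T_{x+y}=T_x\circ T_y$, and $P(T_xA)=P(A)$ for all $A\in\mathcal F$, $x,y\in\mathbb Z^d$. For $\varepsilon>0$, $m_\varepsilon=\varepsilon^d\sum_{x\in\varepsilon\mathbb Z^d}\delta_x$, so $\int_{A}u\,dm_\varepsilon=\varepsilon^d\sum_{x\in A}u(x)$ for $A\subset\varepsilon\mathbb Z^d$; $L^p(\Omega\times\varepsilon\mathbb Z^d)$ is the $L^p$-space for $P\otimes m_\varepsilon$. With $\Box=[-\frac12,\frac12)^d$, $\overline u(x)=u(\lfloor x\rfloor_\varepsilon)$ is the piecewise-constant interpolation of $u:\varepsilon\mathbb Z^d\to\mathbb R$, where $\lfloor x\rfloor_\varepsilon\in\varepsilon\mathbb Z^d$ is defined by $x-\lfloor x\rfloor_\varepsilon\in\varepsilon\Box$. $(\widetilde{\mathcal T}_\varepsilon u)(\omega,x)=u(T_{-x/\varepsilon}\omega,x)$ for $x\in\varepsilon\mathbb Z^d$, and $\mathcal T_\varepsilon u=\overline{\widetilde{\mathcal T}_\varepsilon u}$ (interpolation in $x$), a linear isometry $L^p(\Omega\times\varepsilon\mathbb Z^d)\to L^p(\Omega\times\mathbb R^d)$. $u_\varepsilon\overset{2}{\rightharpoonup}U$ (resp. $u_\varepsilon\overset{2}{\to}U$)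 in $L^p(\Omega\times\mathbb R^d)$ means $\mathcal T_\varepsilon u_\varepsilon\to U$ weakly (resp. strongly) in $L^p(\Omega\times\mathbb R^d)$ as $\varepsilon\to0$, componentwise for vector-valued functions. *)

theory Defs
  imports "HOL-Probability.Probability"
begin

section \<open>Separable measure spaces and measure preserving dynamical systems\<close>

text \<open>Separability of the measure algebra for the metric given by the measure of the symmetric
  difference; for a finite measure this is equivalent to separability of the $L^p$ spaces.\<close>

definition separable_measure :: "'w measure \<Rightarrow> bool" where
  "separable_measure M \<longleftrightarrow>
     (\<exists>D. countable D \<and> D \<subseteq> sets M \<and>
        (\<forall>A\<in>sets M. \<forall>\<delta>>0. \<exists>B\<in>D. measure M ((A - B) \<union> (B - A)) < \<delta>))"

definition scaled_lattice :: "real \<Rightarrow> (real ^ 'd) set" where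
  "scaled_lattice \<epsilon> = {\<epsilon> *\<^sub>R z |z. \<forall>i. z $ i \<in> \<int>}"

text \<open>The family \<open>T\<close> is indexed by \<open>real ^ 'd\<close> so that \<open>T (x /\<^sub>R \<epsilon>)\<close> can be
  written for \<open>x \<in> scaled_lattice \<epsilon>\<close>; only its values at integer points are
  constrained or ever used.\<close>

definition measure_preserving_system ::
    "'w measure \<Rightarrow> (real ^ 'd \<Rightarrow> 'w \<Rightarrow> 'w) \<Rightarrow> bool" where
  "measure_preserving_system M T \<longleftrightarrow>
     (\<forall>x\<in>scaled_lattice 1. T x \<in> M \<rightarrow>\<^sub>M M) \<and>
     (\<forall>\<omega>\<in>space M. T 0 \<omega> = \<omega>) \<and>
     (\<forall>x\<in>scaled_lattice 1. \<forall>y\<in>scaled_lattice 1. \<forall>\<omega>\<in>space M. T (x + y) \<omega> = T x (T y \<omega>)) \<and>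
     (\<forall>x\<in>scaled_lattice 1. \<forall>A\<in>sets M. emeasure M (T x ` A) = emeasure M A)"

definition lattice_measure :: "real \<Rightarrow> (real ^ 'd) measure" where
  "lattice_measure \<epsilon> =
     scale_measure (ennreal (\<epsilon> ^ CARD('d))) (count_space (scaled_lattice \<epsilon>))"


section \<open>Lebesgue spaces\<close>

text \<open>Elements of $L^p$ are represented by functions; all notions below are invariant under
  modification on null sets.\<close>

definition Lp :: "'a measure \<Rightarrow> real \<Rightarrow> ('a \<Rightarrow> real) set" where
  "Lp N p = {f \<in> borel_measurable N. integrable N (\<lambda>z. \<bar>f z\<bar> powr p)}"

definition Lp_vec :: "'a measure \<Rightarrow> real \<Rightarrow> ('a \<Rightarrow> real ^ 'k) set" where
  "Lp_vec N p = {f. \<forall>i. (\<lambda>z. f z $ i) \<in> Lp N p}"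

definition Lp_norm :: "'a measure \<Rightarrow> real \<Rightarrow> ('a \<Rightarrow> real) \<Rightarrow> real" where
  "Lp_norm N p f = (\<integral>z. \<bar>f z\<bar> powr p \<partial>N) powr (1 / p)"

text \<open>The bound forces a functional to vanish on functions that are zero almost everywhere, so
  it descends to equivalence classes.\<close>

definition Lp_dual :: "'a measure \<Rightarrow> real \<Rightarrow> (('a \<Rightarrow> real) \<Rightarrow> real) set" where
  "Lp_dual N p = {\<phi>.
     (\<forall>f\<in>Lp N p. \<forall>g\<in>Lp N p. \<forall>a b. \<phi> (\<lambda>z. a * f z + b * g z) = a * \<phi> f + b * \<phi> g) \<and>
     (\<exists>K. \<forall>f\<in>Lp N p. \<bar>\<phi> f\<bar> \<le> K * Lp_norm N p f)}"

definition Lp_weak_conv ::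
    "'a measure \<Rightarrow> real \<Rightarrow> (real \<Rightarrow> 'a \<Rightarrow> real) \<Rightarrow> ('a \<Rightarrow> real) \<Rightarrow> bool" where
  "Lp_weak_conv N p f g \<longleftrightarrow>
     (\<forall>\<^sub>F \<epsilon> in at_right 0. f \<epsilon> \<in> Lp N p) \<and> g \<in> Lp N p \<and>
     (\<forall>\<phi>\<in>Lp_dual N p. ((\<lambda>\<epsilon>. \<phi> (f \<epsilon>)) \<longlongrightarrow> \<phi> g) (at_right 0))"

definition Lp_strong_conv ::
    "'a measure \<Rightarrow> real \<Rightarrow> (real \<Rightarrow> 'a \<Rightarrow> real) \<Rightarrow> ('a \<Rightarrow> real) \<Rightarrow> bool" where
  "Lp_strong_conv N p f g \<longleftrightarrow>
     (\<forall>\<^sub>F \<epsilon> in at_right 0. f \<epsilon> \<in> Lp N p) \<and> g \<in> Lp N p \<and>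
     ((\<lambda>\<epsilon>. Lp_norm N p (\<lambda>z. f \<epsilon> z - g z)) \<longlongrightarrow> 0) (at_right 0)"


section \<open>Stochastic unfolding and two-scale convergence\<close>

definition unit_cell :: "(real ^ 'd) set" where
  "unit_cell = {z. \<forall>i. - (1/2) \<le> z $ i \<and> z $ i < 1/2}"

definition lattice_floor :: "real \<Rightarrow> real ^ 'd \<Rightarrow> real ^ 'd" where
  "lattice_floor \<epsilon> x =
     (THE y. y \<in> scaled_lattice \<epsilon> \<and> x - y \<in> (\<lambda>z. \<epsilon> *\<^sub>R z) ` unit_cell)"

lemma lattice_floor_eq:
  fixes x :: "real ^ 'd"
  assumes "\<epsilon> > 0"
  shows "lattice_floor \<epsilon> x = (\<chi> i. \<epsilon> * of_int (round (x $ i / \<epsilon>)))"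
  unfolding lattice_floor_def
proof (rule the_equality)
  let ?y = "(\<chi> i. \<epsilon> * of_int (round (x $ i / \<epsilon>))) :: real ^ 'd"
  have "?y = \<epsilon> *\<^sub>R (\<chi> i. of_int (round (x $ i / \<epsilon>)))"
    by (simp add: vec_eq_iff)
  then have "?y \<in> scaled_lattice \<epsilon>"
    unfolding scaled_lattice_def by (auto intro!: exI)
  moreover have "x - ?y = \<epsilon> *\<^sub>R (\<chi> i. x $ i / \<epsilon> - of_int (round (x $ i / \<epsilon>)))"
    using assms by (simp add: vec_eq_iff field_simps)
  moreover have "- (1/2) \<le> t - of_int (round t) \<and> t - of_int (round t) < 1/2" for t :: real
    unfolding round_def by linarith
  then have "(\<chi> i. x $ i / \<epsilon> - of_int (round (x $ i / \<epsilon>))) \<in> unit_cell"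
    unfolding unit_cell_def mem_Collect_eq vec_lambda_beta by blast
  ultimately show "?y \<in> scaled_lattice \<epsilon> \<and> x - ?y \<in> (\<lambda>z. \<epsilon> *\<^sub>R z) ` unit_cell"
    by auto
next
  fix y assume "y \<in> scaled_lattice \<epsilon> \<and> x - y \<in> (\<lambda>z. \<epsilon> *\<^sub>R z) ` unit_cell"
  then obtain z c where z: "y = \<epsilon> *\<^sub>R z" "\<forall>i. z $ i \<in> \<int>"
    and c: "x - y = \<epsilon> *\<^sub>R c" "c \<in> unit_cell"
    unfolding scaled_lattice_def by auto
  have "y $ i = \<epsilon> * of_int (round (x $ i / \<epsilon>))" for i
  proof -
    obtain n where n: "z $ i = of_int n" using z(2) Ints_cases by metis
    have "x = \<epsilon> *\<^sub>R (z + c)" using z(1) c(1) by (simp add: algebra_simps)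
    then have q: "x $ i / \<epsilon> = of_int n + c $ i" using assms n by simp
    have "- (1/2) \<le> c $ i" "c $ i < 1/2" using c(2) by (auto simp: unit_cell_def)
    then have "round (x $ i / \<epsilon>) = n" unfolding q round_def by linarith
    then show ?thesis using z(1) n by simp
  qed
  then show "y = (\<chi> i. \<epsilon> * of_int (round (x $ i / \<epsilon>)))" by (simp add: vec_eq_iff)
qed

definition discrete_unfolding ::
    "(real ^ 'd \<Rightarrow> 'w \<Rightarrow> 'w) \<Rightarrow> real \<Rightarrow> ('w \<times> (real ^ 'd) \<Rightarrow> 'b) \<Rightarrow> 'w \<times> (real ^ 'd) \<Rightarrow> 'b" where
  "discrete_unfolding T \<epsilon> u = (\<lambda>(\<omega>, x). u (T (- x /\<^sub>R \<epsilon>) \<omega>, x))"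

definition interpolation ::
    "real \<Rightarrow> ('w \<times> (real ^ 'd) \<Rightarrow> 'b) \<Rightarrow> 'w \<times> (real ^ 'd) \<Rightarrow> 'b" where
  "interpolation \<epsilon> u = (\<lambda>(\<omega>, x). u (\<omega>, lattice_floor \<epsilon> x))"

definition unfolding_op ::
    "(real ^ 'd \<Rightarrow> 'w \<Rightarrow> 'w) \<Rightarrow> real \<Rightarrow> ('w \<times> (real ^ 'd) \<Rightarrow> 'b) \<Rightarrow> 'w \<times> (real ^ 'd) \<Rightarrow> 'b" where
  "unfolding_op T \<epsilon> u = interpolation \<epsilon> (discrete_unfolding T \<epsilon> u)"

definition two_scale_weak ::
    "'w measure \<Rightarrow> (real ^ 'd \<Rightarrow> 'w \<Rightarrow> 'w) \<Rightarrow> real \<Rightarrow>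
     (real \<Rightarrow> 'w \<times> (real ^ 'd) \<Rightarrow> real ^ 'k) \<Rightarrow> ('w \<times> (real ^ 'd) \<Rightarrow> real ^ 'k) \<Rightarrow> bool" where
  "two_scale_weak M T p u U \<longleftrightarrow>
     (\<forall>i. Lp_weak_conv (M \<Otimes>\<^sub>M lborel) p
            (\<lambda>\<epsilon> z. unfolding_op T \<epsilon> (u \<epsilon>) z $ i) (\<lambda>z. U z $ i))"

definition two_scale_strong ::
    "'w measure \<Rightarrow> (real ^ 'd \<Rightarrow> 'w \<Rightarrow> 'w) \<Rightarrow> real \<Rightarrow>
     (real \<Rightarrow> 'w \<times> (real ^ 'd) \<Rightarrow> real ^ 'k) \<Rightarrow> ('w \<times> (real ^ 'd) \<Rightarrow> real ^ 'k) \<Rightarrow> bool" where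
  "two_scale_strong M T p u U \<longleftrightarrow>
     (\<forall>i. Lp_strong_conv (M \<Otimes>\<^sub>M lborel) p
            (\<lambda>\<epsilon> z. unfolding_op T \<epsilon> (u \<epsilon>) z $ i) (\<lambda>z. U z $ i))"


section \<open>Bounded Lipschitz domains\<close>

text \<open>Near each boundary point the set is the strict epigraph of a Lipschitz function in a
  rotated Cartesian coordinate system. The coordinates are written without reference to
  dimension $d-1$: \<open>n\<close> is the unit vector of the last axis, \<open>x \<bullet> n\<close> the last
  coordinate of \<open>x\<close>, and the remaining ones are replaced by the orthogonal projection of
  \<open>x\<close> to the hyperplane orthogonal to \<open>n\<close>, on which \<open>\<gamma>\<close> is Lipschitz.\<close>

definition lipschitz_boundary :: "(real ^ 'd) set \<Rightarrow> bool" where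
  "lipschitz_boundary S \<longleftrightarrow>
     (\<forall>x\<^sub>0\<in>frontier S. \<exists>r>0. \<exists>n L \<gamma>.
        norm n = 1 \<and> L-lipschitz_on {y. y \<bullet> n = 0} \<gamma> \<and>
        S \<inter> ball x\<^sub>0 r = {x \<in> ball x\<^sub>0 r. x \<bullet> n > \<gamma> (x - (x \<bullet> n) *\<^sub>R n)})"

definition bounded_lipschitz_domain :: "(real ^ 'd) set \<Rightarrow> bool" where
  "bounded_lipschitz_domain S \<longleftrightarrow>
     S \<noteq> {} \<and> open S \<and> connected S \<and> bounded S \<and> lipschitz_boundary S"

end

theory Submission
  imports Defs
begin

text \<open>
  Unfolding turns the statement into one about a fixed integrand. At the lattice point \<open>x\<close> the energy contains
  \<open>V (T (x / \<epsilon>) \<omega>)\<close>; since \<open>T (x / \<epsilon>)\<close> preserves the measure, \<open>\<omega>\<close> may be replaced by \<open>T (- x / \<epsilon>) \<omega>\<close> under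
  the expectation. The discrete energy then equals the integral of \<open>V \<omega> (W \<epsilon> (\<omega>, y))\<close> over \<open>\<Omega> \<times> A \<epsilon>\<close>, where \<open>W \<epsilon>\<close>
  is the unfolded field and \<open>A \<epsilon>\<close> is the set of points that are rounded into \<open>Qp \<epsilon>\<close>
  (\<open>energy_unfolding\<close>). By definition, two-scale convergence is convergence of \<open>W \<epsilon>\<close>. The sets \<open>A \<epsilon>\<close> converge
  to \<open>Q\<close> at every point off the frontier, and the frontier is a null set because a Lipschitz graph
  is disjoint from its vertical translates (\<open>lipschitz_boundary_null\<close>).

  What remains is a statement about a convex integrand with growth of order \<open>p\<close> on a measure space, for moving
  domains of integration.

  The lower bound uses approximate subgradients of \<open>V \<omega>\<close> at \<open>U\<close>. Their slopes may be taken from a countable dense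
  set, as the growth is superlinear, so a measurable choice is the first good slope in an enumeration. On
  a large set the chosen slope is bounded, and there the energy of \<open>W \<epsilon>\<close> is at least that of \<open>U\<close> plus a continuous linear
  functional of \<open>W \<epsilon> - U\<close>, up to a small error; elsewhere the energy density is bounded below
  (\<open>eventually_integral_superposition_gt\<close>).

  For strong convergence the lower bound still applies. The upper bound comes from
  \<open>F = (1 - l) G + l (G + (F - G) / l)\<close> with \<open>F = W \<epsilon>\<close> and \<open>G = U\<close>: convexity bounds the energy of \<open>W \<epsilon>\<close> by that of \<open>U\<close>
  plus \<open>l\<close> times a quantity whose limit as \<open>\<epsilon>\<close> tends to \<open>0\<close> stays bounded for small \<open>l\<close> (\<open>eventually_integral_superposition_less\<close>).
\<close>

section \<open>Lebesgue spaces\<close>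

text \<open>Each entry is at most the largest one, so the sum that bounds the norm is at most the dimension times that entry.\<close>

lemma norm_powr_le_sum_powr:
  fixes v :: "real ^ 'k"
  assumes "p > 0"
  shows "norm v powr p \<le> real CARD('k) powr p * (\<Sum>i\<in>UNIV. \<bar>v $ i\<bar> powr p)"
proof -
  obtain j where j: "\<And>i. \<bar>v $ i\<bar> \<le> \<bar>v $ j\<bar>"
  proof -
    have "Max (range (\<lambda>i. \<bar>v $ i\<bar>)) \<in> range (\<lambda>i. \<bar>v $ i\<bar>)"
      by (rule Max_in) auto
    then obtain j where "Max (range (\<lambda>i. \<bar>v $ i\<bar>)) = \<bar>v $ j\<bar>" by (rule imageE)
    then have "\<bar>v $ i\<bar> \<le> \<bar>v $ j\<bar>" for i
      using Max_ge[of "range (\<lambda>i. \<bar>v $ i\<bar>)" "\<bar>v $ i\<bar>"] by simp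
    then show ?thesis by (rule that)
  qed
  have "norm v \<le> (\<Sum>i\<in>UNIV. \<bar>v $ i\<bar>)" by (rule norm_le_l1_cart)
  also have "\<dots> \<le> real CARD('k) * \<bar>v $ j\<bar>"
    by (rule sum_bounded_above) (use j in simp)
  finally have "norm v powr p \<le> (real CARD('k) * \<bar>v $ j\<bar>) powr p"
    using assms by (intro powr_mono2) auto
  also have "\<dots> = real CARD('k) powr p * \<bar>v $ j\<bar> powr p"
    by (simp add: powr_mult)
  also have "\<dots> \<le> real CARD('k) powr p * (\<Sum>i\<in>UNIV. \<bar>v $ i\<bar> powr p)"
    by (intro mult_left_mono member_le_sum) auto
  finally show ?thesis .
qed

lemma powr_add_le:
  fixes a b p :: real
  assumes "a \<ge> 0" "b \<ge> 0" "p > 0"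
  shows "(a + b) powr p \<le> 2 powr p * (a powr p + b powr p)"
proof -
  have "(a + b) powr p \<le> (2 * max a b) powr p"
    using assms by (intro powr_mono2) auto
  also have "\<dots> = 2 powr p * max a b powr p"
    using assms by (simp add: powr_mult)
  also have "max a b powr p \<le> a powr p + b powr p"
    by (auto simp: max_def)
  finally show ?thesis by (simp add: mult_left_mono)
qed

lemma Lp_vec_measurable:
  assumes "f \<in> Lp_vec N p"
  shows "f \<in> borel_measurable N"
  using assms unfolding Lp_vec_def Lp_def
  by (subst borel_measurable_euclidean_space)
     (auto simp: Basis_vec_def inner_axis)

lemma Lp_vec_integrable_norm_powr:
  fixes f :: "'z \<Rightarrow> real ^ 'k"
  assumes "f \<in> Lp_vec N p" "p > 0"
  shows "integrable N (\<lambda>z. norm (f z) powr p)"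
proof (rule Bochner_Integration.integrable_bound)
  show "integrable N (\<lambda>z. real CARD('k) powr p * (\<Sum>i\<in>UNIV. \<bar>f z $ i\<bar> powr p))"
    using assms unfolding Lp_vec_def Lp_def by auto
  show "(\<lambda>z. norm (f z) powr p) \<in> borel_measurable N"
    using Lp_vec_measurable[OF assms(1)] by measurable
  show "AE z in N. norm (norm (f z) powr p) \<le> norm (real CARD('k) powr p * (\<Sum>i\<in>UNIV. \<bar>f z $ i\<bar> powr p))"
  proof (rule AE_I2)
    fix z
    show "norm (norm (f z) powr p) \<le> norm (real CARD('k) powr p * (\<Sum>i\<in>UNIV. \<bar>f z $ i\<bar> powr p))"
      using norm_powr_le_sum_powr[OF assms(2), of "f z"] by (simp add: abs_of_nonneg)
  qed
qed

lemma Lp_diff: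
  assumes "f \<in> Lp N p" "h \<in> Lp N p" "p > 0"
  shows "(\<lambda>z. f z - h z) \<in> Lp N p"
proof -
  have [measurable]: "f \<in> borel_measurable N" "h \<in> borel_measurable N"
    using assms by (auto simp: Lp_def)
  have "integrable N (\<lambda>z. \<bar>f z - h z\<bar> powr p)"
  proof (rule Bochner_Integration.integrable_bound)
    show "integrable N (\<lambda>z. 2 powr p * (\<bar>f z\<bar> powr p + \<bar>h z\<bar> powr p))"
      using assms unfolding Lp_def by auto
    show "AE z in N. norm (\<bar>f z - h z\<bar> powr p) \<le> norm (2 powr p * (\<bar>f z\<bar> powr p + \<bar>h z\<bar> powr p))"
    proof (rule AE_I2)
      fix z
      have "\<bar>f z - h z\<bar> powr p \<le> (\<bar>f z\<bar> + \<bar>h z\<bar>) powr p"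
        using assms by (intro powr_mono2) auto
      also have "\<dots> \<le> 2 powr p * (\<bar>f z\<bar> powr p + \<bar>h z\<bar> powr p)"
        using assms by (intro powr_add_le) auto
      finally show "norm (\<bar>f z - h z\<bar> powr p) \<le> norm (2 powr p * (\<bar>f z\<bar> powr p + \<bar>h z\<bar> powr p))"
        by simp
    qed
  qed simp
  then show ?thesis by (simp add: Lp_def)
qed

text \<open>The norm bound in the definition of the dual is what a functional needs in order to be continuous.\<close>

lemma Lp_strong_imp_weak:
  assumes "Lp_strong_conv N p f h" "p > 0"
  shows "Lp_weak_conv N p f h"
  unfolding Lp_weak_conv_def
proof (intro conjI ballI)
  have ev: "\<forall>\<^sub>F \<epsilon> in at_right 0. f \<epsilon> \<in> Lp N p" and h: "h \<in> Lp N p"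
    and lim: "((\<lambda>\<epsilon>. Lp_norm N p (\<lambda>z. f \<epsilon> z - h z)) \<longlongrightarrow> 0) (at_right 0)"
    using assms(1) unfolding Lp_strong_conv_def by auto
  then show "\<forall>\<^sub>F \<epsilon> in at_right 0. f \<epsilon> \<in> Lp N p" "h \<in> Lp N p" by auto
  fix \<phi> assume "\<phi> \<in> Lp_dual N p"
  then obtain K where
    lin: "\<And>f g a b. f \<in> Lp N p \<Longrightarrow> g \<in> Lp N p \<Longrightarrow> \<phi> (\<lambda>z. a * f z + b * g z) = a * \<phi> f + b * \<phi> g"
    and K: "\<And>f. f \<in> Lp N p \<Longrightarrow> \<bar>\<phi> f\<bar> \<le> K * Lp_norm N p f"
    unfolding Lp_dual_def mem_Collect_eq by metis
  have "((\<lambda>\<epsilon>. \<phi> (f \<epsilon>) - \<phi> h) \<longlongrightarrow> 0) (at_right 0)"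
  proof (rule Lim_null_comparison)
    show "\<forall>\<^sub>F \<epsilon> in at_right 0. norm (\<phi> (f \<epsilon>) - \<phi> h) \<le> K * Lp_norm N p (\<lambda>z. f \<epsilon> z - h z)"
      using ev
    proof eventually_elim
      case (elim \<epsilon>)
      have "\<phi> (\<lambda>z. f \<epsilon> z - h z) = \<phi> (f \<epsilon>) - \<phi> h"
        using lin[OF elim h, of 1 "-1"] by simp
      then show ?case using K[OF Lp_diff[OF elim h assms(2)]] by simp
    qed
    show "((\<lambda>\<epsilon>. K * Lp_norm N p (\<lambda>z. f \<epsilon> z - h z)) \<longlongrightarrow> 0) (at_right 0)"
      using tendsto_mult_left[OF lim, of K] by simp
  qed
  then show "((\<lambda>\<epsilon>. \<phi> (f \<epsilon>)) \<longlongrightarrow> \<phi> h) (at_right 0)"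
    by (simp add: LIM_zero_iff)
qed

lemma Lp_strong_conv_integral_powr:
  assumes "Lp_strong_conv N p f h" "p > 0"
  shows "((\<lambda>\<epsilon>. \<integral>z. \<bar>f \<epsilon> z - h z\<bar> powr p \<partial>N) \<longlongrightarrow> 0) (at_right 0)"
proof -
  have lim: "((\<lambda>\<epsilon>. Lp_norm N p (\<lambda>z. f \<epsilon> z - h z)) \<longlongrightarrow> 0) (at_right 0)"
    using assms(1) unfolding Lp_strong_conv_def by auto
  have eq: "Lp_norm N p g powr p = (\<integral>z. \<bar>g z\<bar> powr p \<partial>N)" for g :: "'a \<Rightarrow> real"
    unfolding Lp_norm_def powr_powr using assms(2) by (simp add: integral_nonneg_AE)
  have "((\<lambda>\<epsilon>. Lp_norm N p (\<lambda>z. f \<epsilon> z - h z) powr p) \<longlongrightarrow> 0 powr p) (at_right 0)"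
    using assms(2) lim by (intro tendsto_powr') (auto simp: Lp_norm_def)
  then show ?thesis unfolding eq by simp
qed

lemma Lp_strong_conv_integral_norm_powr:
  fixes W :: "real \<Rightarrow> 'z \<Rightarrow> real ^ 'k"
  assumes W: "\<And>i. Lp_strong_conv N p (\<lambda>\<epsilon> z. W \<epsilon> z $ i) (\<lambda>z. U z $ i)" and p: "p > 0"
  shows "((\<lambda>\<epsilon>. \<integral>z. norm (W \<epsilon> z - U z) powr p \<partial>N) \<longlongrightarrow> 0) (at_right 0)"
proof (rule tendsto_sandwich)
  have ev: "\<forall>\<^sub>F \<epsilon> in at_right 0. \<forall>i. (\<lambda>z. W \<epsilon> z $ i) \<in> Lp N p"
    using W unfolding Lp_strong_conv_def by (intro eventually_all_finite) auto
  show "\<forall>\<^sub>F \<epsilon> in at_right 0. 0 \<le> (\<integral>z. norm (W \<epsilon> z - U z) powr p \<partial>N)"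
    by (intro always_eventually allI integral_nonneg_AE AE_I2) simp
  show "\<forall>\<^sub>F \<epsilon> in at_right 0. (\<integral>z. norm (W \<epsilon> z - U z) powr p \<partial>N)
     \<le> real CARD('k) powr p * (\<Sum>i\<in>UNIV. \<integral>z. \<bar>W \<epsilon> z $ i - U z $ i\<bar> powr p \<partial>N)"
    using ev
  proof eventually_elim
    case (elim \<epsilon>)
    have U: "(\<lambda>z. U z $ i) \<in> Lp N p" for i using W[of i] unfolding Lp_strong_conv_def by blast
    have D: "(\<lambda>z. W \<epsilon> z $ i - U z $ i) \<in> Lp N p" for i
      by (rule Lp_diff[OF _ U p]) (use elim in blast)
    have DV: "(\<lambda>z. W \<epsilon> z - U z) \<in> Lp_vec N p" using D by (simp add: Lp_vec_def)
    have i: "integrable N (\<lambda>z. \<bar>W \<epsilon> z $ i - U z $ i\<bar> powr p)" for i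
      using D[of i] unfolding Lp_def by blast
    have "(\<integral>z. norm (W \<epsilon> z - U z) powr p \<partial>N)
      \<le> (\<integral>z. real CARD('k) powr p * (\<Sum>i\<in>UNIV. \<bar>W \<epsilon> z $ i - U z $ i\<bar> powr p) \<partial>N)"
    proof (rule integral_mono)
      show "integrable N (\<lambda>z. norm (W \<epsilon> z - U z) powr p)"
        by (rule Lp_vec_integrable_norm_powr[OF DV p])
      show "integrable N (\<lambda>z. real CARD('k) powr p * (\<Sum>i\<in>UNIV. \<bar>W \<epsilon> z $ i - U z $ i\<bar> powr p))"
        by (intro integrable_mult_right Bochner_Integration.integrable_sum i)
      show "norm (W \<epsilon> z - U z) powr p \<le> real CARD('k) powr p * (\<Sum>i\<in>UNIV. \<bar>W \<epsilon> z $ i - U z $ i\<bar> powr p)" for z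
        using norm_powr_le_sum_powr[OF p, of "W \<epsilon> z - U z"] by simp
    qed
    also have "\<dots> = real CARD('k) powr p * (\<Sum>i\<in>UNIV. \<integral>z. \<bar>W \<epsilon> z $ i - U z $ i\<bar> powr p \<partial>N)"
      by (simp only: integral_mult_right_zero Bochner_Integration.integral_sum[OF i])
    finally show ?case .
  qed
  have "((\<lambda>\<epsilon>. \<integral>z. \<bar>W \<epsilon> z $ i - U z $ i\<bar> powr p \<partial>N) \<longlongrightarrow> 0) (at_right 0)" for i
    by (rule Lp_strong_conv_integral_powr[OF W p])
  then have "((\<lambda>\<epsilon>. real CARD('k) powr p * (\<Sum>i\<in>UNIV. \<integral>z. \<bar>W \<epsilon> z $ i - U z $ i\<bar> powr p \<partial>N))
     \<longlongrightarrow> real CARD('k) powr p * (\<Sum>i\<in>(UNIV :: 'k set). 0)) (at_right 0)"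
    by (intro tendsto_mult_left tendsto_sum)
  then show "((\<lambda>\<epsilon>. real CARD('k) powr p * (\<Sum>i\<in>UNIV. \<integral>z. \<bar>W \<epsilon> z $ i - U z $ i\<bar> powr p \<partial>N)) \<longlongrightarrow> 0) (at_right 0)"
    by simp
qed simp

lemma le_one_plus_powr:
  fixes t p :: real
  assumes "p \<ge> 1" "t \<ge> 0"
  shows "t \<le> 1 + t powr p"
proof (cases "t \<le> 1")
  case True
  then show ?thesis using powr_ge_zero[of t p] by linarith
next
  case False
  then have "t powr 1 \<le> t powr p" using assms by (intro powr_mono) auto
  then show ?thesis using False by simp
qed

lemma bounded_indicator_mult_le:
  fixes b f B p :: real
  assumes "p \<ge> 1" "z \<in> E \<Longrightarrow> \<bar>b\<bar> \<le> B"
  shows "\<bar>indicator E z * b * f\<bar> \<le> \<bar>B\<bar> * (indicator E z + \<bar>f\<bar> powr p)"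
proof (cases "z \<in> E")
  case True
  then have "\<bar>b\<bar> * \<bar>f\<bar> \<le> \<bar>B\<bar> * (1 + \<bar>f\<bar> powr p)"
    using assms le_one_plus_powr[of p "\<bar>f\<bar>"] by (intro mult_mono) auto
  then show ?thesis using True by (simp add: abs_mult)
qed simp

lemma integrable_bounded_mult_Lp:
  assumes p: "p \<ge> 1" and E: "E \<in> sets N" "emeasure N E < \<infinity>"
    and b: "b \<in> borel_measurable N" and B: "\<And>z. z \<in> E \<Longrightarrow> \<bar>b z\<bar> \<le> B"
    and f: "f \<in> Lp N p"
  shows "integrable N (\<lambda>z. indicator E z * b z * f z)"
proof (rule Bochner_Integration.integrable_bound)
  have "integrable N (indicator E :: _ \<Rightarrow> real)" using E by simp
  then show "integrable N (\<lambda>z. \<bar>B\<bar> * (indicator E z + \<bar>f z\<bar> powr p))"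
    using f unfolding Lp_def by auto
  show "(\<lambda>z. indicator E z * b z * f z) \<in> borel_measurable N"
    using f b E(1) unfolding Lp_def by auto
  show "AE z in N. norm (indicator E z * b z * f z) \<le> norm (\<bar>B\<bar> * (indicator E z + \<bar>f z\<bar> powr p))"
  proof (rule AE_I2)
    fix z
    show "norm (indicator E z * b z * f z) \<le> norm (\<bar>B\<bar> * (indicator E z + \<bar>f z\<bar> powr p))"
      using bounded_indicator_mult_le[OF p B, where f="f z"] unfolding real_norm_def
      by (rule order_trans[OF _ abs_ge_self])
  qed
qed

text \<open>Bounded functions supported on a set of finite measure are the only test functions needed below, and for
  them the dual bound is elementary: \<open>t \<le> 1 + t\<^sup>p\<close> bounds the integral when the norm is \<open>1\<close>, and
  homogeneity reduces the general case to this one.\<close>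

lemma integral_bounded_mult_le_Lp_norm:
  assumes p: "p \<ge> 1" and E: "E \<in> sets N" "emeasure N E < \<infinity>"
    and b: "b \<in> borel_measurable N" and B: "\<And>z. z \<in> E \<Longrightarrow> \<bar>b z\<bar> \<le> B"
    and f: "f \<in> Lp N p"
  shows "\<bar>\<integral>z. indicator E z * b z * f z \<partial>N\<bar> \<le> \<bar>B\<bar> * (measure N E + 1) * Lp_norm N p f"
proof -
  have fi: "integrable N (\<lambda>z. \<bar>f z\<bar> powr p)" using f by (auto simp: Lp_def)
  have indI: "integrable N (indicator E :: _ \<Rightarrow> real)" using E by simp
  have int: "integrable N (\<lambda>z. indicator E z * b z * f z)"
    by (rule integrable_bounded_mult_Lp[OF p E b B f])
  define t where "t = Lp_norm N p f"
  have t0: "t \<ge> 0" by (simp add: t_def Lp_norm_def)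
  have tp: "t powr p = (\<integral>z. \<bar>f z\<bar> powr p \<partial>N)"
    unfolding t_def Lp_norm_def powr_powr using p by (simp add: integral_nonneg_AE)
  show ?thesis
  proof (cases "t = 0")
    case True
    then have "(\<integral>z. \<bar>f z\<bar> powr p \<partial>N) = 0" using tp p by simp
    then have "AE z in N. \<bar>f z\<bar> powr p = 0"
      using integral_nonneg_eq_0_iff_AE[OF fi] by simp
    then have "AE z in N. indicator E z * b z * f z = 0"
      by eventually_elim simp
    then have "(\<integral>z. indicator E z * b z * f z \<partial>N) = 0"
      by (rule integral_eq_zero_AE)
    then show ?thesis using True by (simp add: t_def)
  next
    case False
    then have t: "t > 0" using t0 by simp
    let ?h = "\<lambda>z. t * (\<bar>B\<bar> * (indicator E z + \<bar>f z\<bar> powr p / t powr p))"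
    have hI: "integrable N ?h"
      by (intro integrable_mult_right Bochner_Integration.integrable_add indI integrable_divide fi)
    have le: "\<bar>indicator E z * b z * f z\<bar> \<le> ?h z" for z
    proof -
      have "\<bar>indicator E z * b z * (f z / t)\<bar> \<le> \<bar>B\<bar> * (indicator E z + \<bar>f z / t\<bar> powr p)"
        by (rule bounded_indicator_mult_le[OF p B])
      also have "\<bar>f z / t\<bar> powr p = \<bar>f z\<bar> powr p / t powr p"
        using t by (simp add: powr_divide abs_divide)
      finally have "t * \<bar>indicator E z * b z * (f z / t)\<bar> \<le> ?h z"
        using t by (intro mult_left_mono) auto
      moreover have "t * \<bar>indicator E z * b z * (f z / t)\<bar> = \<bar>indicator E z * b z * f z\<bar>"
        using t by (simp add: abs_mult abs_divide)
      ultimately show ?thesis by simp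
    qed
    have "\<bar>\<integral>z. indicator E z * b z * f z \<partial>N\<bar> \<le> (\<integral>z. \<bar>indicator E z * b z * f z\<bar> \<partial>N)"
      by (rule integral_abs_bound)
    also have "\<dots> \<le> (\<integral>z. ?h z \<partial>N)"
      by (rule integral_mono[OF integrable_abs[OF int] hI le])
    also have "\<dots> = t * (\<bar>B\<bar> * (measure N E + (\<integral>z. \<bar>f z\<bar> powr p \<partial>N) / t powr p))"
      using indI fi E by simp
    also have "\<dots> = \<bar>B\<bar> * (measure N E + 1) * t"
      unfolding tp[symmetric] using t by simp
    finally show ?thesis unfolding t_def .
  qed
qed

lemma bounded_finite_support_in_Lp_dual:
  assumes p: "p \<ge> 1" and E: "E \<in> sets N" "emeasure N E < \<infinity>"
    and b: "b \<in> borel_measurable N" and B: "\<And>z. z \<in> E \<Longrightarrow> \<bar>b z\<bar> \<le> B"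
  shows "(\<lambda>f. \<integral>z. indicator E z * b z * f z \<partial>N) \<in> Lp_dual N p"
proof -
  have lin: "(\<integral>z. indicator E z * b z * (a * f z + c * g z) \<partial>N) =
       a * (\<integral>z. indicator E z * b z * f z \<partial>N) + c * (\<integral>z. indicator E z * b z * g z \<partial>N)"
    if f: "f \<in> Lp N p" and g: "g \<in> Lp N p" for f g a c
  proof -
    note int = integrable_bounded_mult_Lp[OF p E b B]
    have "(\<integral>z. indicator E z * b z * (a * f z + c * g z) \<partial>N) =
       (\<integral>z. a * (indicator E z * b z * f z) + c * (indicator E z * b z * g z) \<partial>N)"
      by (rule Bochner_Integration.integral_cong[OF refl]) (simp only: distrib_left mult.left_commute)
    also have "\<dots> = (\<integral>z. a * (indicator E z * b z * f z) \<partial>N) + (\<integral>z. c * (indicator E z * b z * g z) \<partial>N)"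
      by (intro Bochner_Integration.integral_add integrable_mult_right int f g)
    finally show ?thesis by (simp only: integral_mult_right_zero)
  qed
  have bound: "\<bar>\<integral>z. indicator E z * b z * f z \<partial>N\<bar> \<le> \<bar>B\<bar> * (measure N E + 1) * Lp_norm N p f"
    if "f \<in> Lp N p" for f
    using integral_bounded_mult_le_Lp_norm[OF p E b B that] .
  show ?thesis
    unfolding Lp_dual_def mem_Collect_eq
    by (rule conjI, intro ballI allI, erule (1) lin, rule exI, rule ballI, erule bound)
qed

section \<open>Approximate affine supports of convex functions\<close>

text \<open>A point slightly below the graph is strictly separated from the closed convex epigraph by a hyperplane.
  The hyperplane is not vertical, because the point has the epigraph straight above it, so it is the graph
  of an affine minorant.\<close>

lemma affine_approx_support:
  fixes f :: "'a::euclidean_space \<Rightarrow> real"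
  assumes f: "convex_on UNIV f" and \<eta>: "\<eta> > 0"
  shows "\<exists>b. \<forall>x. f x > f a - \<eta> + b \<bullet> (x - a)"
proof -
  have cont: "continuous_on UNIV f"
    using convex_on_continuous[OF open_UNIV f] .
  have cl: "closed (epigraph UNIV f)"
  proof -
    have "closed {z. f (fst z) \<le> snd z}"
      using cont
      by (intro closed_Collect_le continuous_on_compose2[OF cont] continuous_intros) auto
    then show ?thesis by (simp add: epigraph_def)
  qed
  have cv: "convex (epigraph UNIV f)" using f by (simp add: convex_epigraph)
  have notin: "(a, f a - \<eta>) \<notin> epigraph UNIV f" using \<eta> by (simp add: mem_epigraph)
  obtain c \<beta> where c: "c \<bullet> (a, f a - \<eta>) < \<beta>" "\<And>z. z \<in> epigraph UNIV f \<Longrightarrow> c \<bullet> z > \<beta>"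
    using separating_hyperplane_closed_point[OF cv cl notin] by blast
  obtain v s where vs: "c = (v, s)" by (cases c)
  have lo: "v \<bullet> a + s * (f a - \<eta>) < \<beta>" using c(1) by (simp add: vs)
  have up: "v \<bullet> x + s * f x > \<beta>" for x
    using c(2)[of "(x, f x)"] by (simp add: vs mem_epigraph)
  have "s * (f a - \<eta>) < s * f a" using lo up[of a] by linarith
  then have "s * \<eta> > 0" by (simp add: algebra_simps)
  then have s: "s > 0" using \<eta> by (simp add: zero_less_mult_iff)
  have "f x > f a - \<eta> + (- v /\<^sub>R s) \<bullet> (x - a)" for x
  proof -
    have "s * (f a - \<eta> + (- v /\<^sub>R s) \<bullet> (x - a)) = s * (f a - \<eta>) - v \<bullet> (x - a)"
    proof -
      have "s * ((- v /\<^sub>R s) \<bullet> (x - a)) = - (v \<bullet> (x - a))" using s by simp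
      then show ?thesis by (simp only: distrib_left)
    qed
    also have "\<dots> < s * f x" using lo up[of x] by (simp add: inner_diff_right)
    finally show ?thesis using s by simp
  qed
  then show ?thesis by blast
qed

lemma powr_superlinear:
  fixes p C A B :: real
  assumes p: "p > 1" and C: "C > 0"
  shows "\<exists>R. \<forall>t\<ge>R. A * t + B \<le> 1 / C * t powr p"
proof -
  have "filterlim (\<lambda>t::real. t powr (p - 1)) at_top at_top"
    using p by (intro real_powr_at_top) (auto simp: filterlim_ident)
  then have "\<forall>\<^sub>F t::real in at_top. C * (A + \<bar>B\<bar>) \<le> t powr (p - 1)"
    by (simp add: filterlim_at_top)
  then have "\<forall>\<^sub>F t::real in at_top. A * t + B \<le> 1 / C * t powr p"
    using eventually_ge_at_top[of "1::real"]
  proof eventually_elim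
    case (elim t)
    have "B \<le> \<bar>B\<bar> * t" using elim(2) mult_left_mono[of 1 t "\<bar>B\<bar>"] by simp
    then have "A * t + B \<le> (A + \<bar>B\<bar>) * t" by (simp add: distrib_right)
    also have "\<dots> = 1 / C * (C * (A + \<bar>B\<bar>) * t)" using C by simp
    also have "\<dots> \<le> 1 / C * (t powr (p - 1) * t)"
      using C elim by (intro mult_left_mono mult_right_mono) auto
    also have "t powr (p - 1) * t = t powr p" using elim(2) by (simp add: powr_diff)
    finally show ?case .
  qed
  then show ?thesis by (simp add: eventually_at_top_linorder)
qed

text \<open>The slope of an affine minorant may be moved into any dense set. Moving the slope by a small \<open>\<rho>\<close>
  costs up to \<open>\<rho>\<close> times the distance from \<open>a\<close>, which is unbounded. Near \<open>a\<close> this is absorbed by \<open>\<eta>\<close>; far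
  from \<open>a\<close> the superlinear growth leaves room for one additional unit of slope. Choosing slopes from
  a countable dense set is what later makes a measurable selection of approximate subgradients trivial.\<close>

lemma affine_approx_support_dense:
  fixes f :: "'a::euclidean_space \<Rightarrow> real"
  assumes f: "convex_on UNIV f" and \<eta>: "\<eta> > 0" and p: "p > 1" and C: "C > 0"
    and growth: "\<And>x. 1 / C * norm x powr p - C \<le> f x"
    and dense: "\<And>S. open S \<Longrightarrow> S \<noteq> {} \<Longrightarrow> \<exists>d\<in>D. d \<in> S"
  shows "\<exists>b\<in>D. \<forall>x. f x \<ge> f a - \<eta> + b \<bullet> (x - a)"
proof -
  obtain b where b: "\<And>x. f x > f a - \<eta> / 2 + b \<bullet> (x - a)"
    using affine_approx_support[OF f, of "\<eta> / 2"] \<eta> by auto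
  define A where "A = norm b + 1"
  define B where "B = \<bar>f a\<bar> + C + A * norm a"
  obtain R where R: "\<And>t. t \<ge> R \<Longrightarrow> A * t + B \<le> 1 / C * t powr p"
    using powr_superlinear[OF p C] by metis
  \<comment> \<open>Beyond distance \<open>R'\<close> from \<open>a\<close>, the growth bound leaves one unit of slope more than \<open>norm b\<close>.\<close>
  define R' where "R' = \<bar>R\<bar> + norm a + 1"
  have R'0: "R' > 0" unfolding R'_def using norm_ge_zero[of a] abs_ge_zero[of R] by linarith
  have far: "f x \<ge> f a + (norm b + 1) * norm (x - a)" if "norm (x - a) \<ge> R'" for x
  proof -
    have nx: "R \<le> norm x"
      using that norm_triangle_ineq4[of x a] unfolding R'_def by linarith
    have "1 / C * norm x powr p \<ge> A * norm x + B" using R[OF nx] .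
    then have "f x \<ge> A * (norm x + norm a) + \<bar>f a\<bar>"
      using growth[of x] unfolding B_def distrib_left by linarith
    moreover have "A * norm (x - a) \<le> A * (norm x + norm a)"
      by (intro mult_left_mono norm_triangle_ineq4) (simp add: A_def)
    ultimately have "f x \<ge> f a + A * norm (x - a)" by linarith
    then show ?thesis unfolding A_def .
  qed
  \<comment> \<open>The bound \<open>1\<close> serves the far region, the other bound the region within distance \<open>R'\<close>.\<close>
  define \<rho> where "\<rho> = min 1 (\<eta> / (2 * R'))"
  have \<rho>: "\<rho> > 0" using \<eta> R'0 by (simp add: \<rho>_def)
  obtain d where d: "d \<in> D" "d \<in> ball b \<rho>"
    using dense[of "ball b \<rho>"] \<rho> by (metis centre_in_ball empty_iff open_ball)
  have "f x \<ge> f a - \<eta> + d \<bullet> (x - a)" for x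
  proof -
    have nd: "norm (d - b) \<le> \<rho>" using d(2) by (simp add: dist_norm norm_minus_commute)
    have cs: "(d - b) \<bullet> (x - a) \<le> \<rho> * norm (x - a)"
      by (rule order_trans[OF norm_cauchy_schwarz mult_right_mono[OF nd]]) simp
    show ?thesis
    proof (cases "norm (x - a) \<ge> R'")
      case True
      have "b \<bullet> (x - a) \<le> norm b * norm (x - a)" by (rule norm_cauchy_schwarz)
      moreover have "\<rho> * norm (x - a) \<le> 1 * norm (x - a)"
        by (intro mult_right_mono) (auto simp: \<rho>_def)
      ultimately have "d \<bullet> (x - a) \<le> (norm b + 1) * norm (x - a)"
        using cs by (simp add: inner_diff_left algebra_simps)
      then show ?thesis using far[OF True] \<eta> by linarith
    next
      case False
      have "\<rho> * norm (x - a) \<le> \<eta> / (2 * R') * R'"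
        using False \<eta> R'0 by (intro mult_mono) (auto simp: \<rho>_def)
      then have "\<rho> * norm (x - a) \<le> \<eta> / 2" using R'0 by simp
      then show ?thesis using b[of x] cs by (simp add: inner_diff_left)
    qed
  qed
  then show ?thesis using d(1) by blast
qed

section \<open>Integrals over converging domains\<close>

lemma integral_indicator_tendsto_sequence:
  fixes h :: "'z \<Rightarrow> real"
  assumes h: "integrable N (\<lambda>z. indicator B z * h z)"
    and E: "\<And>m. E m \<in> sets N" "\<And>m. E m \<subseteq> B" and X: "X \<in> sets N" "X \<subseteq> B"
    and ev: "AE z in N. \<forall>\<^sub>F m in sequentially. (z \<in> E m \<longleftrightarrow> z \<in> X)"
  shows "(\<lambda>m. \<integral>z. indicator (E m) z * h z \<partial>N) \<longlonglongrightarrow> (\<integral>z. indicator X z * h z \<partial>N)"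
proof -
  have meas: "(\<lambda>z. indicator Y z * h z) \<in> borel_measurable N" if "Y \<in> sets N" "Y \<subseteq> B" for Y
  proof -
    have "(\<lambda>z. indicator Y z * h z) = (\<lambda>z. indicator Y z * (indicator B z * h z))"
      using that(2) by (auto simp: indicator_def fun_eq_iff)
    also have "\<dots> \<in> borel_measurable N"
      by (rule borel_measurable_times[OF borel_measurable_indicator[OF that(1)] borel_measurable_integrable[OF h]])
    finally show ?thesis .
  qed
  show ?thesis
  proof (rule integral_dominated_convergence)
    show "integrable N (\<lambda>z. \<bar>indicator B z * h z\<bar>)" using h by (rule integrable_abs)
    show "(\<lambda>z. indicator X z * h z) \<in> borel_measurable N" using meas[OF X] .
    show "(\<lambda>z. indicator (E m) z * h z) \<in> borel_measurable N" for m using meas[OF E] .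
    show "AE z in N. (\<lambda>m. indicator (E m) z * h z) \<longlonglongrightarrow> indicator X z * h z"
      using ev
    proof eventually_elim
      case (elim z)
      then have "\<forall>\<^sub>F m in sequentially. indicator (E m) z * h z = indicator X z * h z"
        by eventually_elim (simp add: indicator_def)
      then show ?case by (rule tendsto_eventually)
    qed
    show "AE z in N. norm (indicator (E m) z * h z) \<le> \<bar>indicator B z * h z\<bar>" for m
      using E(2)[of m] by (intro AE_I2) (auto simp: indicator_def)
  qed
qed

lemma integral_indicator_tendsto_at_right:
  fixes h :: "'z \<Rightarrow> real" and A :: "real \<Rightarrow> 'z set"
  assumes h: "integrable N (\<lambda>z. indicator B z * h z)"
    and A: "\<And>\<epsilon>. 0 < \<epsilon> \<Longrightarrow> \<epsilon> < 1 \<Longrightarrow> A \<epsilon> \<in> sets N" "\<And>\<epsilon>. 0 < \<epsilon> \<Longrightarrow> \<epsilon> < 1 \<Longrightarrow> A \<epsilon> \<subseteq> B"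
    and X: "X \<in> sets N" "X \<subseteq> B"
    and ev: "AE z in N. \<forall>\<^sub>F \<epsilon> in at_right 0. (z \<in> A \<epsilon> \<longleftrightarrow> z \<in> X)"
  shows "((\<lambda>\<epsilon>. \<integral>z. indicator (A \<epsilon>) z * h z \<partial>N) \<longlongrightarrow> (\<integral>z. indicator X z * h z \<partial>N)) (at_right 0)"
proof (rule tendsto_at_right_sequentially[of _ 1])
  fix S :: "nat \<Rightarrow> real"
  assume S: "\<And>n. 0 < S n" "\<And>n. S n < 1" "S \<longlonglongrightarrow> 0"
  have lim: "filterlim S (at_right 0) sequentially"
    unfolding filterlim_at using S by (auto simp: less_imp_neq[THEN not_sym])
  show "(\<lambda>n. \<integral>z. indicator (A (S n)) z * h z \<partial>N) \<longlonglongrightarrow> (\<integral>z. indicator X z * h z \<partial>N)"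
  proof (rule integral_indicator_tendsto_sequence[OF h A(1) A(2) X])
    show "AE z in N. \<forall>\<^sub>F n in sequentially. (z \<in> A (S n) \<longleftrightarrow> z \<in> X)"
      using ev
    proof eventually_elim
      case (elim z)
      then show ?case using lim unfolding filterlim_iff by blast
    qed
  qed (use S in auto)
qed simp

section \<open>Convex integral functionals under weak and strong convergence\<close>

locale convex_integrand =
  fixes N :: "'z measure" and g :: "'z \<Rightarrow> real ^ 'k \<Rightarrow> real" and p C :: real
  assumes p: "1 < p" and C: "0 < C"
    and joint_measurable: "(\<lambda>(z, F). g z F) \<in> borel_measurable (N \<Otimes>\<^sub>M borel)"
    and AE_convex: "AE z in N. convex_on UNIV (g z)"
    and AE_growth: "AE z in N. \<forall>F. 1 / C * norm F powr p - C \<le> g z F \<and> g z F \<le> C * (norm F powr p + 1)"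
begin

lemma measurable_superposition:
  assumes "f \<in> borel_measurable N"
  shows "(\<lambda>z. g z (f z)) \<in> borel_measurable N"
proof -
  have "(\<lambda>z. (z, f z)) \<in> N \<rightarrow>\<^sub>M N \<Otimes>\<^sub>M borel" using assms by simp
  from measurable_compose[OF this joint_measurable] show ?thesis by simp
qed

lemma AE_lower: "AE z in N. \<forall>F. - C \<le> g z F"
  using AE_growth
proof eventually_elim
  case (elim z)
  show ?case
  proof
    fix F :: "real ^ 'k"
    have "0 \<le> 1 / C * norm F powr p" using C by simp
    then show "- C \<le> g z F" using elim[rule_format, of F] by linarith
  qed
qed

lemma integrable_superposition:
  assumes f: "f \<in> Lp_vec N p" and B: "B \<in> sets N" "emeasure N B < \<infinity>"
  shows "integrable N (\<lambda>z. indicator B z * g z (f z))"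
proof (rule Bochner_Integration.integrable_bound)
  have "integrable N (indicator B :: _ \<Rightarrow> real)" using B by simp
  then show "integrable N (\<lambda>z. C * (norm (f z) powr p + indicator B z))"
    using Lp_vec_integrable_norm_powr[OF f] p
    by (intro integrable_mult_right Bochner_Integration.integrable_add) auto
  show "(\<lambda>z. indicator B z * g z (f z)) \<in> borel_measurable N"
    using B(1) by (intro borel_measurable_times borel_measurable_indicator measurable_superposition Lp_vec_measurable[OF f])
  show "AE z in N. norm (indicator B z * g z (f z)) \<le> norm (C * (norm (f z) powr p + indicator B z))"
    using AE_growth AE_lower
  proof eventually_elim
    case (elim z)
    have "\<bar>g z (f z)\<bar> \<le> C * (norm (f z) powr p + 1)"
    proof (rule abs_leI)
      show "g z (f z) \<le> C * (norm (f z) powr p + 1)" using elim(1) by blast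
      have "C * 0 \<le> C * norm (f z) powr p" using C by (intro mult_left_mono) auto
      then show "- g z (f z) \<le> C * (norm (f z) powr p + 1)"
        using elim(2)[rule_format, of "f z"] by (simp add: distrib_left)
    qed
    moreover have "0 \<le> C * (norm (f z) powr p + indicator B z)" using C by simp
    ultimately show ?case by (cases "z \<in> B") auto
  qed
qed

text \<open>Measurable selection of approximate subgradients at \<open>U\<close>: the set \<open>S n\<close> collects the points where the slope
  \<open>b n\<close> is good. Only countably many test points enter its definition, which makes it measurable, and continuity
  of convex functions recovers the inequality at all points.\<close>

lemma countable_affine_support:
  assumes U: "U \<in> borel_measurable N" and \<eta>: "\<eta> > 0"
  obtains b :: "nat \<Rightarrow> real ^ 'k" and S where "\<And>n. S n \<in> sets N" "AE z in N. \<exists>n. z \<in> S n"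
    "AE z in N. \<forall>n. z \<in> S n \<longrightarrow> (\<forall>F. g z (U z) - \<eta> + b n \<bullet> (F - U z) \<le> g z F)"
proof -
  obtain D :: "(real ^ 'k) set" where D: "countable D"
    and dense: "\<And>Y. open Y \<Longrightarrow> Y \<noteq> {} \<Longrightarrow> \<exists>d\<in>D. d \<in> Y"
    using countable_dense_exists by metis
  have D0: "D \<noteq> {}" using dense[of UNIV] by auto
  define b where "b = from_nat_into D"
  have rb: "range b = D" unfolding b_def by (rule range_from_nat_into[OF D0 D])
  define S where "S n = {z \<in> space N. \<forall>j. g z (U z) - \<eta> + b n \<bullet> (b j - U z) \<le> g z (b j)}" for n
  have "S n \<in> sets N" for n
    unfolding S_def
  proof (rule sets.sets_Collect_countable_All)
    fix j
    have 1: "(\<lambda>z. g z (U z) - \<eta> + b n \<bullet> (b j - U z)) \<in> borel_measurable N"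
      using measurable_superposition[OF U] U by simp
    have 2: "(\<lambda>z. g z (b j)) \<in> borel_measurable N"
      by (rule measurable_superposition) simp
    show "{z \<in> space N. g z (U z) - \<eta> + b n \<bullet> (b j - U z) \<le> g z (b j)} \<in> sets N"
      using 1 2 by (rule borel_measurable_le)
  qed
  moreover have "AE z in N. \<exists>n. z \<in> S n"
    using AE_convex AE_growth AE_space
  proof eventually_elim
    case (elim z)
    have "\<exists>\<beta>\<in>D. \<forall>F. g z F \<ge> g z (U z) - \<eta> + \<beta> \<bullet> (F - U z)"
    proof (rule affine_approx_support_dense[OF elim(1) \<eta> p C])
      show "1 / C * norm F powr p - C \<le> g z F" for F using elim(2) by blast
      show "\<exists>d\<in>D. d \<in> Y" if "open Y" "Y \<noteq> {}" for Y using dense[OF that] .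
    qed
    then obtain \<beta> where \<beta>: "\<beta> \<in> D" "\<And>F. g z F \<ge> g z (U z) - \<eta> + \<beta> \<bullet> (F - U z)" by blast
    obtain n where "b n = \<beta>" using \<beta>(1) unfolding rb[symmetric] by blast
    then have "z \<in> S n" using \<beta>(2) elim(3) by (simp add: S_def)
    then show ?case ..
  qed
  moreover have "AE z in N. \<forall>n. z \<in> S n \<longrightarrow> (\<forall>F. g z (U z) - \<eta> + b n \<bullet> (F - U z) \<le> g z F)"
    using AE_convex
  proof eventually_elim
    case (elim z)
    have cont: "continuous_on UNIV (g z)" using convex_on_continuous[OF open_UNIV elim] .
    show ?case
    proof (intro allI impI)
      fix n F assume z: "z \<in> S n"
      let ?Y = "{F. g z F < g z (U z) - \<eta> + b n \<bullet> (F - U z)}"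
      have "open ?Y"
        by (intro open_Collect_less cont continuous_intros)
      moreover have "\<not> (\<exists>d\<in>D. d \<in> ?Y)" using z unfolding rb[symmetric] by (auto simp: S_def not_less)
      ultimately have "?Y = {}" using dense by blast
      then show "g z (U z) - \<eta> + b n \<bullet> (F - U z) \<le> g z F" by (auto simp: not_less[symmetric])
    qed
  qed
  ultimately show ?thesis by (rule that)
qed

text \<open>Weak lower semicontinuity, with domains of integration that vary. On a set \<open>E\<close> where finitely many of the
  slopes from \<open>countable_affine_support\<close> suffice, the integrand lies above an affine function with a bounded slope
  \<open>\<beta>\<close>, so the error \<open>\<beta> \<bullet> (W - U)\<close> is a bounded functional of \<open>W - U\<close> and vanishes by weak convergence.
  Off \<open>E\<close> the integrand is at least \<open>-C\<close>, and the measure left over is small. The inner exhaustion \<open>K\<close> keeps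
  \<open>E\<close> inside the moving domains, so that one fixed functional serves for all small \<open>\<epsilon>\<close>.\<close>

lemma eventually_integral_superposition_gt:
  fixes A :: "real \<Rightarrow> 'z set" and K :: "nat \<Rightarrow> 'z set"
  assumes X: "X \<in> sets N" "emeasure N X < \<infinity>"
    and A: "\<And>\<epsilon>. 0 < \<epsilon> \<Longrightarrow> \<epsilon> < 1 \<Longrightarrow> A \<epsilon> \<in> sets N" "\<And>\<epsilon>. 0 < \<epsilon> \<Longrightarrow> \<epsilon> < 1 \<Longrightarrow> emeasure N (A \<epsilon>) < \<infinity>"
    and \<mu>A: "((\<lambda>\<epsilon>. measure N (A \<epsilon>)) \<longlongrightarrow> measure N X) (at_right 0)"
    and K: "\<And>m. K m \<in> sets N" "\<And>m. K m \<subseteq> X"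
      "\<And>z. z \<in> X \<Longrightarrow> \<forall>\<^sub>F m in sequentially. z \<in> K m"
      "\<And>m. \<forall>\<^sub>F \<epsilon> in at_right 0. K m \<subseteq> A \<epsilon>"
    and U: "U \<in> Lp_vec N p"
    and W: "\<And>i. Lp_weak_conv N p (\<lambda>\<epsilon> z. W \<epsilon> z $ i) (\<lambda>z. U z $ i)"
    and c: "c < (\<integral>z. indicator X z * g z (U z) \<partial>N)"
  shows "\<forall>\<^sub>F \<epsilon> in at_right 0. c < (\<integral>z. indicator (A \<epsilon>) z * g z (W \<epsilon> z) \<partial>N)"
proof -
  define h where "h z = g z (U z)" for z
  define J where "J = (\<integral>z. indicator X z * h z \<partial>N)"
  define \<mu> where "\<mu> = measure N X"
  have \<mu>0: "\<mu> \<ge> 0" by (simp add: \<mu>_def)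
  have cJ: "c < J" using c by (simp add: J_def h_def)
  \<comment> \<open>Adding \<open>1\<close> keeps the divisor positive and \<open>\<eta> * \<mu>\<close> strictly below the gap \<open>J - c\<close>.\<close>
  define d where "d = \<mu> + 1"
  have d: "d > 0" "\<mu> < d" unfolding d_def using \<mu>0 by auto
  define \<eta> where "\<eta> = (J - c) / d"
  have \<eta>: "\<eta> > 0" unfolding \<eta>_def by (rule divide_pos_pos) (use cJ d in simp_all)
  have \<eta>\<mu>: "c < J - \<eta> * \<mu>"
  proof -
    have "\<eta> * \<mu> < \<eta> * d" using d(2) \<eta> by (rule mult_strict_left_mono)
    also have "\<dots> = J - c" using d(1) unfolding \<eta>_def by simp
    finally show ?thesis by simp
  qed
  have Um: "U \<in> borel_measurable N" using Lp_vec_measurable[OF U] .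
  obtain b :: "nat \<Rightarrow> real ^ 'k" and S where S: "\<And>n. S n \<in> sets N" "AE z in N. \<exists>n. z \<in> S n"
    and supp: "AE z in N. \<forall>n. z \<in> S n \<longrightarrow> (\<forall>F. g z (U z) - \<eta> + b n \<bullet> (F - U z) \<le> g z F)"
    using countable_affine_support[OF Um \<eta>] by blast
  \<comment> \<open>Restricting to the first \<open>m\<close> slopes makes the selected slope bounded on \<open>E m\<close>.\<close>
  define E where "E m = K m \<inter> (\<Union>n\<le>m. S n)" for m
  have E: "E m \<in> sets N" "E m \<subseteq> X" for m
  proof -
    show "E m \<in> sets N"
      unfolding E_def by (intro sets.Int sets.finite_UN K(1) S(1)) simp
    show "E m \<subseteq> X" unfolding E_def using K(2) by (rule le_infI1)
  qed
  have Efin: "emeasure N (E m) < \<infinity>" for m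
    by (rule le_less_trans[OF emeasure_mono[OF E(2) X(1)] X(2)])
  have hX: "integrable N (\<lambda>z. indicator X z * h z)"
    unfolding h_def by (rule integrable_superposition[OF U X])
  have hE: "integrable N (\<lambda>z. indicator (E m) z * h z)" for m
    unfolding h_def by (rule integrable_superposition[OF U E(1) Efin])
  have Eev: "AE z in N. \<forall>\<^sub>F m in sequentially. (z \<in> E m \<longleftrightarrow> z \<in> X)"
    using S(2)
  proof eventually_elim
    case (elim z)
    then obtain n where n: "z \<in> S n" ..
    show ?case
    proof (cases "z \<in> X")
      case True
      show ?thesis using K(3)[OF True] eventually_ge_at_top[of n]
        by eventually_elim (use n True in \<open>auto simp: E_def\<close>)
    next
      case False
      then show ?thesis using E(2) by (intro always_eventually) auto
    qed
  qed
  have lim_h: "(\<lambda>m. \<integral>z. indicator (E m) z * h z \<partial>N) \<longlonglongrightarrow> J"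
    unfolding J_def by (rule integral_indicator_tendsto_sequence[OF hX E X(1) order_refl Eev])
  have "(\<lambda>m. \<integral>z. indicator (E m) z * (1::real) \<partial>N) \<longlonglongrightarrow> (\<integral>z. indicator X z * (1::real) \<partial>N)"
    by (rule integral_indicator_tendsto_sequence[OF _ E X(1) order_refl Eev]) (use X in simp)
  then have lim_\<mu>: "(\<lambda>m. measure N (E m)) \<longlonglongrightarrow> \<mu>"
    using sets.sets_into_space[OF E(1)] sets.sets_into_space[OF X(1)]
    by (simp add: \<mu>_def Int_absorb2)
  have "(\<lambda>m. (\<integral>z. indicator (E m) z * h z \<partial>N) - \<eta> * measure N (E m) - C * (\<mu> - measure N (E m)))
     \<longlonglongrightarrow> J - \<eta> * \<mu> - C * (\<mu> - \<mu>)"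
    by (intro tendsto_intros lim_h lim_\<mu>)
  then have "\<forall>\<^sub>F m in sequentially. c < (\<integral>z. indicator (E m) z * h z \<partial>N) - \<eta> * measure N (E m) - C * (\<mu> - measure N (E m))"
    by (rule order_tendstoD(1)) (use \<eta>\<mu> in simp)
  then obtain m where m: "c < (\<integral>z. indicator (E m) z * h z \<partial>N) - \<eta> * measure N (E m) - C * (\<mu> - measure N (E m))"
    using eventually_happens' [OF sequentially_bot] by blast
  define \<beta> where "\<beta> z = b (LEAST n. z \<in> S n)" for z
  have \<beta>m: "(\<lambda>z. \<beta> z $ i) \<in> borel_measurable N" for i
  proof -
    have "(\<lambda>z. LEAST n. z \<in> S n) \<in> N \<rightarrow>\<^sub>M count_space UNIV"
      by (rule measurable_Least) (use S(1) in simp)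
    then have "(\<lambda>z. b (LEAST n. z \<in> S n) $ i) \<in> borel_measurable N"
      by (rule measurable_compose) simp
    then show ?thesis by (simp add: \<beta>_def)
  qed
  have least: "(LEAST n. z \<in> S n) \<le> m \<and> z \<in> S (LEAST n. z \<in> S n)" if zE: "z \<in> E m" for z
  proof -
    obtain n where n: "n \<le> m" "z \<in> S n" using zE by (auto simp: E_def)
    show ?thesis using Least_le[of "\<lambda>n. z \<in> S n", OF n(2)] LeastI[of "\<lambda>n. z \<in> S n", OF n(2)] n(1) by auto
  qed
  have \<beta>b: "\<bar>\<beta> z $ i\<bar> \<le> (\<Sum>n\<le>m. norm (b n))" if "z \<in> E m" for z i
  proof -
    have "\<bar>\<beta> z $ i\<bar> \<le> norm (\<beta> z)" by (rule component_le_norm_cart)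
    also have "\<dots> \<le> (\<Sum>n\<le>m. norm (b n))"
      unfolding \<beta>_def using least[OF that] by (intro member_le_sum) auto
    finally show ?thesis .
  qed
  define \<phi> where "\<phi> i f = (\<integral>z. indicator (E m) z * (\<beta> z $ i) * f z \<partial>N)" for i f
  have p1: "1 \<le> p" using p by simp
  have \<phi>: "\<phi> i \<in> Lp_dual N p" for i
    unfolding \<phi>_def by (rule bounded_finite_support_in_Lp_dual[OF p1 E(1) Efin \<beta>m]) (rule \<beta>b)
  have \<phi>_int: "integrable N (\<lambda>z. indicator (E m) z * (\<beta> z $ i) * f z)" if "f \<in> Lp N p" for f i
    by (rule integrable_bounded_mult_Lp[OF p1 E(1) Efin \<beta>m _ that]) (rule \<beta>b)
  have U_Lp: "(\<lambda>z. U z $ i) \<in> Lp N p" for i using U by (simp add: Lp_vec_def)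
  \<comment> \<open>The lower bound for the energy obtained by integrating the affine minorant on \<open>E m\<close> and \<open>-C\<close> on the rest of \<open>A \<epsilon>\<close>.\<close>
  define R where "R \<epsilon> = (\<integral>z. indicator (E m) z * h z \<partial>N) - \<eta> * measure N (E m)
     + (\<Sum>i\<in>UNIV. \<phi> i (\<lambda>z. W \<epsilon> z $ i) - \<phi> i (\<lambda>z. U z $ i)) - C * (measure N (A \<epsilon>) - measure N (E m))" for \<epsilon>
  have "(R \<longlongrightarrow> (\<integral>z. indicator (E m) z * h z \<partial>N) - \<eta> * measure N (E m)
     + (\<Sum>i\<in>(UNIV :: 'k set). \<phi> i (\<lambda>z. U z $ i) - \<phi> i (\<lambda>z. U z $ i)) - C * (\<mu> - measure N (E m))) (at_right 0)"
  proof -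
    have "((\<lambda>\<epsilon>. \<phi> i (\<lambda>z. W \<epsilon> z $ i)) \<longlongrightarrow> \<phi> i (\<lambda>z. U z $ i)) (at_right 0)" for i
      using W[of i] \<phi>[of i] unfolding Lp_weak_conv_def by blast
    then show ?thesis
      unfolding R_def \<mu>_def by (intro tendsto_intros \<mu>A)
  qed
  then have Rc: "\<forall>\<^sub>F \<epsilon> in at_right 0. c < R \<epsilon>"
    by (rule order_tendstoD(1)) (use m in simp)
  have W_Lp: "\<forall>\<^sub>F \<epsilon> in at_right 0. \<forall>i. (\<lambda>z. W \<epsilon> z $ i) \<in> Lp N p"
    using W unfolding Lp_weak_conv_def by (intro eventually_all_finite) auto
  have "\<forall>\<^sub>F \<epsilon> in at_right (0::real). 0 < \<epsilon> \<and> \<epsilon> < 1"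
    using eventually_at_right_real[of 0 1] by simp
  with Rc W_Lp K(4)[of m] show ?thesis
  proof eventually_elim
    case (elim \<epsilon>)
    have \<epsilon>: "0 < \<epsilon>" "\<epsilon> < 1" using elim(4) by auto
    have WL: "W \<epsilon> \<in> Lp_vec N p" and Wi: "(\<lambda>z. W \<epsilon> z $ i) \<in> Lp N p" for i
      using elim(2) by (auto simp: Lp_vec_def)
    have EA: "E m \<subseteq> A \<epsilon>" using elim(3) by (auto simp: E_def)
    let ?r = "\<lambda>z. indicator (E m) z * h z - \<eta> * indicator (E m) z
       + (\<Sum>i\<in>UNIV. indicator (E m) z * (\<beta> z $ i) * (W \<epsilon> z $ i) - indicator (E m) z * (\<beta> z $ i) * (U z $ i))
       - C * (indicator (A \<epsilon>) z - indicator (E m) z)"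
    have iE: "integrable N (indicator (E m) :: 'z \<Rightarrow> real)" using E(1) Efin by simp
    have iA: "integrable N (indicator (A \<epsilon>) :: 'z \<Rightarrow> real)" using A[OF \<epsilon>] by simp
    have sE: "(\<integral>z. indicator (E m) z \<partial>N) = measure N (E m)"
      using sets.sets_into_space[OF E(1)] by (simp add: Int_absorb2)
    have sA: "(\<integral>z. indicator (A \<epsilon>) z \<partial>N) = measure N (A \<epsilon>)"
      using sets.sets_into_space[OF A(1)[OF \<epsilon>]] by (simp add: Int_absorb2)
    note i1 = \<phi>_int[OF Wi] and i2 = \<phi>_int[OF U_Lp]
    have i3: "integrable N (\<lambda>z. \<Sum>i\<in>UNIV. indicator (E m) z * (\<beta> z $ i) * (W \<epsilon> z $ i) - indicator (E m) z * (\<beta> z $ i) * (U z $ i))"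
      by (rule Bochner_Integration.integrable_sum) (rule Bochner_Integration.integrable_diff[OF i1 i2])
    have i4: "integrable N (\<lambda>z. indicator (E m) z * h z - \<eta> * indicator (E m) z)"
      by (rule Bochner_Integration.integrable_diff[OF hE integrable_mult_right[OF iE]])
    have i5: "integrable N (\<lambda>z. C * (indicator (A \<epsilon>) z - indicator (E m) z))"
      by (rule integrable_mult_right[OF Bochner_Integration.integrable_diff[OF iA iE]])
    have s3: "(\<integral>z. (\<Sum>i\<in>UNIV. indicator (E m) z * (\<beta> z $ i) * (W \<epsilon> z $ i) - indicator (E m) z * (\<beta> z $ i) * (U z $ i)) \<partial>N)
       = (\<Sum>i\<in>UNIV. \<phi> i (\<lambda>z. W \<epsilon> z $ i) - \<phi> i (\<lambda>z. U z $ i))"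
    proof (subst Bochner_Integration.integral_sum)
      show "integrable N (\<lambda>z. indicator (E m) z * (\<beta> z $ i) * (W \<epsilon> z $ i) - indicator (E m) z * (\<beta> z $ i) * (U z $ i))" for i
        by (rule Bochner_Integration.integrable_diff[OF i1 i2])
    qed (simp only: \<phi>_def Bochner_Integration.integral_diff[OF i1 i2])
    have s4: "(\<integral>z. indicator (E m) z * h z - \<eta> * indicator (E m) z \<partial>N) = (\<integral>z. indicator (E m) z * h z \<partial>N) - \<eta> * measure N (E m)"
      by (simp only: Bochner_Integration.integral_diff[OF hE integrable_mult_right[OF iE]] integral_mult_right_zero sE)
    have s5: "(\<integral>z. C * (indicator (A \<epsilon>) z - indicator (E m) z) \<partial>N) = C * (measure N (A \<epsilon>) - measure N (E m))"
      by (simp only: Bochner_Integration.integral_diff[OF iA iE] integral_mult_right_zero sE sA)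
    have "R \<epsilon> = integral\<^sup>L N ?r"
      unfolding R_def
      by (simp only: Bochner_Integration.integral_diff[OF Bochner_Integration.integrable_add[OF i4 i3] i5]
          Bochner_Integration.integral_add[OF i4 i3] s3 s4 s5)
    also have "\<dots> \<le> (\<integral>z. indicator (A \<epsilon>) z * g z (W \<epsilon> z) \<partial>N)"
    proof (rule integral_mono_AE)
      show "integrable N ?r"
        by (rule Bochner_Integration.integrable_diff[OF Bochner_Integration.integrable_add[OF i4 i3] i5])
      show "integrable N (\<lambda>z. indicator (A \<epsilon>) z * g z (W \<epsilon> z))"
        by (rule integrable_superposition[OF WL A(1)[OF \<epsilon>] A(2)[OF \<epsilon>]])
      show "AE z in N. ?r z \<le> indicator (A \<epsilon>) z * g z (W \<epsilon> z)"
        using supp AE_lower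
      proof eventually_elim
        case (elim z)
        show ?case
        proof (cases "z \<in> E m")
          case True
          have "h z - \<eta> + \<beta> z \<bullet> (W \<epsilon> z - U z) \<le> g z (W \<epsilon> z)"
            unfolding h_def \<beta>_def using elim(1) least[OF True] by blast
          moreover have "\<beta> z \<bullet> (W \<epsilon> z - U z) = (\<Sum>i\<in>UNIV. (\<beta> z $ i) * (W \<epsilon> z $ i) - (\<beta> z $ i) * (U z $ i))"
            by (simp add: inner_vec_def right_diff_distrib)
          moreover have "z \<in> A \<epsilon>" using True EA by blast
          ultimately show ?thesis using True by simp
        next
          case False
          then show ?thesis using elim(2)[rule_format, of "W \<epsilon> z"] by (simp add: indicator_def)
        qed
      qed
    qed
    finally show ?case using elim(1) by linarith
  qed
qed

text \<open>Write \<open>F\<close> as the convex combination of \<open>G\<close>, with weight \<open>1 - l\<close>, and \<open>G + (F - G) / l\<close>. The growth bound is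
  spent only on the second point, which carries the small weight \<open>l\<close>.\<close>

lemma AE_convex_upper:
  assumes l: "0 < l" "l < 1"
  shows "AE z in N. \<forall>F G. g z F \<le> (1 - l) * g z G
    + l * C * (2 powr p * norm G powr p + 2 powr p * (1 / l) powr p * norm (F - G) powr p + 1)"
  using AE_convex AE_growth
proof eventually_elim
  case (elim z)
  show ?case
  proof (intro allI)
    fix F G :: "real ^ 'k"
    define H where "H = G + (1 / l) *\<^sub>R (F - G)"
    have F: "F = (1 - l) *\<^sub>R G + l *\<^sub>R H"
      using l(1) by (simp add: H_def algebra_simps)
    have "g z F \<le> (1 - l) * g z G + l * g z H"
      unfolding F using l by (intro convex_onD[OF elim(1)]) auto
    also have "g z H \<le> C * (norm H powr p + 1)" using elim(2) by blast
    also have "norm H powr p \<le> 2 powr p * (norm G powr p + ((1 / l) * norm (F - G)) powr p)"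
    proof -
      have "norm H \<le> norm G + (1 / l) * norm (F - G)"
        unfolding H_def using norm_triangle_ineq[of G "(1 / l) *\<^sub>R (F - G)"] l by simp
      then have "norm H powr p \<le> (norm G + (1 / l) * norm (F - G)) powr p"
        using p by (intro powr_mono2) auto
      also have "\<dots> \<le> 2 powr p * (norm G powr p + ((1 / l) * norm (F - G)) powr p)"
        using p l by (intro powr_add_le) auto
      finally show ?thesis .
    qed
    also have "((1 / l) * norm (F - G)) powr p = (1 / l) powr p * norm (F - G) powr p"
      by (rule powr_mult)
    finally show "g z F \<le> (1 - l) * g z G
      + l * C * (2 powr p * norm G powr p + 2 powr p * (1 / l) powr p * norm (F - G) powr p + 1)"
      using l C by (simp add: distrib_left mult.assoc)
  qed
qed

text \<open>Integrate \<open>AE_convex_upper\<close> for \<open>F = W\<close> and \<open>G = U\<close>. As \<open>\<epsilon>\<close> tends to \<open>0\<close> with \<open>l\<close> fixed, the term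
  with \<open>W - U\<close> disappears; what remains exceeds the limit by a multiple of \<open>l\<close>.\<close>

lemma eventually_integral_superposition_less:
  fixes A :: "real \<Rightarrow> 'z set"
  assumes A: "\<And>\<epsilon>. 0 < \<epsilon> \<Longrightarrow> \<epsilon> < 1 \<Longrightarrow> A \<epsilon> \<in> sets N" "\<And>\<epsilon>. 0 < \<epsilon> \<Longrightarrow> \<epsilon> < 1 \<Longrightarrow> emeasure N (A \<epsilon>) < \<infinity>"
    and \<mu>A: "((\<lambda>\<epsilon>. measure N (A \<epsilon>)) \<longlongrightarrow> \<mu>) (at_right 0)"
    and gA: "((\<lambda>\<epsilon>. \<integral>z. indicator (A \<epsilon>) z * g z (U z) \<partial>N) \<longlongrightarrow> J) (at_right 0)"
    and U: "U \<in> Lp_vec N p"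
    and W: "\<And>i. Lp_strong_conv N p (\<lambda>\<epsilon> z. W \<epsilon> z $ i) (\<lambda>z. U z $ i)"
    and c: "J < c"
  shows "\<forall>\<^sub>F \<epsilon> in at_right 0. (\<integral>z. indicator (A \<epsilon>) z * g z (W \<epsilon> z) \<partial>N) < c"
proof -
  define n where "n \<epsilon> = (\<integral>z. norm (W \<epsilon> z - U z) powr p \<partial>N)" for \<epsilon>
  define \<nu> where "\<nu> = (\<integral>z. norm (U z) powr p \<partial>N)"
  have p0: "p > 0" using p by simp
  have n: "(n \<longlongrightarrow> 0) (at_right 0)"
    using Lp_strong_conv_integral_norm_powr[OF W p0] by (simp add: n_def[abs_def])
  have "((\<lambda>l. (1 - l) * J + l * C * (2 powr p * \<nu> + \<mu>)) \<longlongrightarrow> (1 - 0) * J + 0 * C * (2 powr p * \<nu> + \<mu>)) (at_right 0)"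
    by (intro tendsto_intros)
  then have "\<forall>\<^sub>F l in at_right 0. (1 - l) * J + l * C * (2 powr p * \<nu> + \<mu>) < c"
    by (rule order_tendstoD(2)) (use c in simp)
  moreover have unit: "\<forall>\<^sub>F l in at_right (0::real). 0 < l \<and> l < 1"
    using eventually_at_right_real[of 0 1] by simp
  ultimately have "\<forall>\<^sub>F l in at_right 0. ((1 - l) * J + l * C * (2 powr p * \<nu> + \<mu>) < c) \<and> 0 < l \<and> l < 1"
    by (rule eventually_conj)
  \<comment> \<open>The weight \<open>l\<close> is fixed before \<open>\<epsilon>\<close>: the constant \<open>q\<close> below blows up as \<open>l\<close> tends to \<open>0\<close>.\<close>
  then obtain l where l: "(1 - l) * J + l * C * (2 powr p * \<nu> + \<mu>) < c" "0 < l" "l < 1"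
    using eventually_happens'[OF trivial_limit_at_right_real] by blast
  define q where "q = 2 powr p * (1 / l) powr p"
  define R where "R \<epsilon> = (1 - l) * (\<integral>z. indicator (A \<epsilon>) z * g z (U z) \<partial>N)
     + l * C * (2 powr p * \<nu> + q * n \<epsilon> + measure N (A \<epsilon>))" for \<epsilon>
  have "(R \<longlongrightarrow> (1 - l) * J + l * C * (2 powr p * \<nu> + q * 0 + \<mu>)) (at_right 0)"
    unfolding R_def by (intro tendsto_intros gA \<mu>A n)
  then have Rc: "\<forall>\<^sub>F \<epsilon> in at_right 0. R \<epsilon> < c"
    by (rule order_tendstoD(2)) (use l(1) in simp)
  have W_Lp: "\<forall>\<^sub>F \<epsilon> in at_right 0. \<forall>i. (\<lambda>z. W \<epsilon> z $ i) \<in> Lp N p"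
    using W unfolding Lp_strong_conv_def by (intro eventually_all_finite) auto
  from Rc W_Lp unit show ?thesis
  proof eventually_elim
    case (elim \<epsilon>)
    have \<epsilon>: "0 < \<epsilon>" "\<epsilon> < 1" using elim(3) by auto
    have WL: "W \<epsilon> \<in> Lp_vec N p" using elim(2) by (simp add: Lp_vec_def)
    have D: "(\<lambda>z. W \<epsilon> z - U z) \<in> Lp_vec N p"
      unfolding Lp_vec_def
    proof (intro CollectI allI)
      fix i
      show "(\<lambda>z. (W \<epsilon> z - U z) $ i) \<in> Lp N p"
        using Lp_diff[of "\<lambda>z. W \<epsilon> z $ i" N p "\<lambda>z. U z $ i"] WL U p0 by (simp add: Lp_vec_def)
    qed
    note iD = Lp_vec_integrable_norm_powr[OF D p0] and iU = Lp_vec_integrable_norm_powr[OF U p0]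
    have iA: "integrable N (indicator (A \<epsilon>) :: 'z \<Rightarrow> real)" using A[OF \<epsilon>] by simp
    have sA: "(\<integral>z. indicator (A \<epsilon>) z \<partial>N) = measure N (A \<epsilon>)"
      using sets.sets_into_space[OF A(1)[OF \<epsilon>]] by (simp add: Int_absorb2)
    let ?s = "\<lambda>z. 2 powr p * norm (U z) powr p + q * norm (W \<epsilon> z - U z) powr p"
    let ?r = "\<lambda>z. (1 - l) * (indicator (A \<epsilon>) z * g z (U z)) + l * C * (?s z + indicator (A \<epsilon>) z)"
    have is1: "integrable N ?s"
      by (rule Bochner_Integration.integrable_add[OF integrable_mult_right[OF iU] integrable_mult_right[OF iD]])
    have iG: "integrable N (\<lambda>z. indicator (A \<epsilon>) z * g z (U z))"
      by (rule integrable_superposition[OF U A(1)[OF \<epsilon>] A(2)[OF \<epsilon>]])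
    have "(\<integral>z. indicator (A \<epsilon>) z * g z (W \<epsilon> z) \<partial>N) \<le> integral\<^sup>L N ?r"
    proof (rule integral_mono_AE)
      show "integrable N (\<lambda>z. indicator (A \<epsilon>) z * g z (W \<epsilon> z))"
        by (rule integrable_superposition[OF WL A(1)[OF \<epsilon>] A(2)[OF \<epsilon>]])
      show "integrable N ?r"
        by (rule Bochner_Integration.integrable_add[OF integrable_mult_right[OF iG]
              integrable_mult_right[OF Bochner_Integration.integrable_add[OF is1 iA]]])
      show "AE z in N. indicator (A \<epsilon>) z * g z (W \<epsilon> z) \<le> ?r z"
        using AE_convex_upper[OF l(2,3)]
      proof eventually_elim
        case (elim z)
        show ?case
        proof (cases "z \<in> A \<epsilon>")
          case True
          then show ?thesis using elim[rule_format, of "W \<epsilon> z" "U z"] by (simp add: q_def)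
        next
          case False
          have "0 \<le> l * C * ?s z"
            using l C by (intro mult_nonneg_nonneg add_nonneg_nonneg) (auto simp: q_def)
          then show ?thesis using False by simp
        qed
      qed
    qed
    also have "\<dots> = R \<epsilon>"
      by (simp only: R_def n_def \<nu>_def sA integral_mult_right_zero
          Bochner_Integration.integral_add[OF integrable_mult_right[OF iG]
              integrable_mult_right[OF Bochner_Integration.integrable_add[OF is1 iA]]]
          Bochner_Integration.integral_add[OF is1 iA]
          Bochner_Integration.integral_add[OF integrable_mult_right[OF iU] integrable_mult_right[OF iD]])
    finally show ?case using elim(1) by linarith
  qed
qed

end

section \<open>Frontiers of Lipschitz domains\<close>

text \<open>If the set had positive measure, its translates by \<open>v / m\<close> would be infinitely many disjoint sets of the
  same positive measure inside one ball.\<close>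

lemma null_set_if_translates_disjoint:
  fixes B :: "'a::euclidean_space set" and v :: 'a
  assumes B: "B \<in> sets lborel" "bounded B"
    and disj: "\<And>x t. x \<in> B \<Longrightarrow> x + t *\<^sub>R v \<in> B \<Longrightarrow> t = 0"
  shows "B \<in> null_sets lborel"
proof -
  define T where "T m = (\<lambda>x. (1 / real (Suc m)) *\<^sub>R v + x) ` B" for m :: nat
  have T_eq: "T m = (\<lambda>x. - ((1 / real (Suc m)) *\<^sub>R v) + x) -` B \<inter> space lborel" for m
  proof -
    have "x \<in> T m" if "- ((1 / real (Suc m)) *\<^sub>R v) + x \<in> B" for x
      unfolding T_def using that by (intro image_eqI[where x="- ((1 / real (Suc m)) *\<^sub>R v) + x"]) auto
    then show ?thesis by (auto simp: T_def)
  qed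
  have T_sets: "T m \<in> sets lborel" for m
    unfolding T_eq using B(1) by (intro measurable_sets[of _ lborel lborel]) simp_all
  have T_em: "emeasure lborel (T m) = emeasure lborel B" for m
  proof -
    have "emeasure lborel B = emeasure (distr lborel borel ((+) (- ((1 / real (Suc m)) *\<^sub>R v)))) B"
      by (simp add: lborel_distr_plus)
    also have "\<dots> = emeasure lborel (T m)"
      unfolding T_eq using B(1) by (subst emeasure_distr) (simp_all add: space_borel)
    finally show ?thesis by simp
  qed
  have T_disj: "disjoint_family T"
    unfolding disjoint_family_on_def
  proof (intro ballI impI)
    fix m n :: nat assume mn: "m \<noteq> n"
    show "T m \<inter> T n = {}"
    proof (rule ccontr)
      assume "T m \<inter> T n \<noteq> {}"
      then obtain x y where xy: "x \<in> B" "y \<in> B" "(1 / real (Suc m)) *\<^sub>R v + x = (1 / real (Suc n)) *\<^sub>R v + y"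
        by (auto simp: T_def)
      have "y = x + (1 / real (Suc m) - 1 / real (Suc n)) *\<^sub>R v"
        using xy(3) by (simp add: scaleR_diff_left algebra_simps)
      then have "1 / real (Suc m) - 1 / real (Suc n) = 0" using disj xy(1,2) by blast
      then have "inverse (real (Suc m)) = inverse (real (Suc n))" by (simp only: inverse_eq_divide right_minus_eq)
      then show False using mn by (simp only: inverse_eq_iff_eq of_nat_eq_iff nat.inject)
    qed
  qed
  obtain r where r: "\<And>x. x \<in> B \<Longrightarrow> norm x \<le> r" using B(2) by (auto simp: bounded_iff)
  have sub: "(\<Union>m. T m) \<subseteq> cball 0 (norm v + r)"
  proof
    fix y assume "y \<in> (\<Union>m. T m)"
    then obtain m x where x: "x \<in> B" "y = (1 / real (Suc m)) *\<^sub>R v + x" by (auto simp: T_def)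
    have "norm ((1 / real (Suc m)) *\<^sub>R v) \<le> 1 * norm v"
      unfolding norm_scaleR by (intro mult_right_mono) auto
    then show "y \<in> cball 0 (norm v + r)"
      using x(2) r[OF x(1)] norm_triangle_ineq[of "(1 / real (Suc m)) *\<^sub>R v" x] by simp
  qed
  have "(\<Sum>m. emeasure lborel (T m)) = emeasure lborel (\<Union>m. T m)"
    using T_sets T_disj by (intro suminf_emeasure) auto
  also have "\<dots> \<le> emeasure lborel (cball (0::'a) (norm v + r))"
    using sub by (intro emeasure_mono) auto
  also have "\<dots> < \<infinity>" by (rule emeasure_lborel_cball_finite)
  finally have fin: "(\<Sum>m::nat. emeasure lborel B) < \<infinity>" unfolding T_em .
  have "emeasure lborel B = 0"
  proof (rule ccontr)
    assume "emeasure lborel B \<noteq> 0"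
    then have "(\<Sum>m::nat. emeasure lborel B) = \<infinity>"
      unfolding nn_integral_count_space_nat[symmetric] by (simp add: ennreal_mult_top)
    then show False using fin by simp
  qed
  then show ?thesis using B(1) by auto
qed

text \<open>A frontier point of an open set is not in the set, hence not above the graph. It is not strictly below either,
  since a neighbourhood of such a point misses the set.\<close>

lemma frontier_on_graph:
  fixes S :: "(real ^ 'd) set"
  assumes op: "open S" and n: "norm n = 1" and lip: "L-lipschitz_on {y. y \<bullet> n = 0} \<gamma>"
    and graph: "S \<inter> ball x0 r = {x \<in> ball x0 r. x \<bullet> n > \<gamma> (x - (x \<bullet> n) *\<^sub>R n)}"
    and x: "x \<in> frontier S" "x \<in> ball x0 r"
  shows "x \<bullet> n = \<gamma> (x - (x \<bullet> n) *\<^sub>R n)"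
proof -
  define P where "P y = y - (y \<bullet> n) *\<^sub>R n" for y :: "real ^ 'd"
  have nn: "n \<bullet> n = 1" using n by (simp add: norm_eq_1)
  have P: "P y \<in> {y. y \<bullet> n = 0}" for y by (simp add: P_def inner_diff_left nn)
  have cont: "continuous_on UNIV (\<lambda>y. \<gamma> (P y))"
  proof (rule continuous_on_compose2[OF lipschitz_on_continuous_on[OF lip]])
    show "continuous_on UNIV P" unfolding P_def by (intro continuous_intros)
    show "P ` UNIV \<subseteq> {y. y \<bullet> n = 0}" using P by blast
  qed
  have "x \<notin> S" using x(1) op by (simp add: frontier_def interior_open)
  have le: "x \<bullet> n \<le> \<gamma> (P x)"
  proof (rule ccontr)
    assume "\<not> ?thesis"
    then have "x \<in> S \<inter> ball x0 r" unfolding graph using x(2) by (simp add: P_def)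
    then show False using \<open>x \<notin> S\<close> by blast
  qed
  have "\<not> x \<bullet> n < \<gamma> (P x)"
  proof
    assume lt: "x \<bullet> n < \<gamma> (P x)"
    let ?Y = "{y. y \<bullet> n < \<gamma> (P y)} \<inter> ball x0 r"
    have "continuous_on UNIV (\<lambda>y. y \<bullet> n)" by (intro continuous_intros)
    from open_Int[OF open_Collect_less[OF this cont] open_ball] have "open ?Y" .
    moreover have "x \<in> ?Y \<inter> closure S" using lt x by (simp add: frontier_def)
    ultimately have "?Y \<inter> S \<noteq> {}" using open_Int_closure_eq_empty[of ?Y S] by blast
    then obtain y where y: "y \<in> S" "y \<in> ball x0 r" "y \<bullet> n < \<gamma> (P y)" by blast
    then have "y \<in> {x \<in> ball x0 r. x \<bullet> n > \<gamma> (x - (x \<bullet> n) *\<^sub>R n)}" unfolding graph[symmetric] by blast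
    then have "y \<bullet> n > \<gamma> (P y)" unfolding P_def by blast
    then show False using y(3) by simp
  qed
  then show ?thesis using le unfolding P_def by simp
qed

text \<open>In a small ball the frontier lies on a graph over the hyperplane orthogonal to \<open>n\<close>, and a graph meets each line
  in the direction \<open>n\<close> at most once, so \<open>null_set_if_translates_disjoint\<close> applies with \<open>v = n\<close>.\<close>

lemma lipschitz_boundary_null:
  fixes S :: "(real ^ 'd) set"
  assumes op: "open S" and lb: "lipschitz_boundary S"
  shows "frontier S \<in> null_sets lborel"
proof -
  have "negligible (frontier S)"
  proof (subst locally_negligible_alt, intro ballI)
    fix x assume x: "x \<in> frontier S"
    obtain r n L \<gamma> where r: "r > 0" and n: "norm n = 1" and lip: "L-lipschitz_on {y. y \<bullet> n = 0} \<gamma>"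
      and graph: "S \<inter> ball x r = {x' \<in> ball x r. x' \<bullet> n > \<gamma> (x' - (x' \<bullet> n) *\<^sub>R n)}"
      using lb x unfolding lipschitz_boundary_def by meson
    let ?B = "frontier S \<inter> ball x r"
    have nn: "n \<bullet> n = 1" using n by (simp add: norm_eq_1)
    have "?B \<in> null_sets lborel"
    proof (rule null_set_if_translates_disjoint)
      show "?B \<in> sets lborel" by simp
      show "bounded ?B" by (simp add: bounded_Int)
      fix y t assume y: "y \<in> ?B" and yt: "y + t *\<^sub>R n \<in> ?B"
      have 1: "y \<bullet> n = \<gamma> (y - (y \<bullet> n) *\<^sub>R n)"
        using frontier_on_graph[OF op n lip graph] y by blast
      have 2: "(y + t *\<^sub>R n) \<bullet> n = \<gamma> ((y + t *\<^sub>R n) - ((y + t *\<^sub>R n) \<bullet> n) *\<^sub>R n)"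
        using frontier_on_graph[OF op n lip graph] yt by blast
      have 3: "(y + t *\<^sub>R n) \<bullet> n = y \<bullet> n + t" by (simp add: inner_add_left nn)
      have 4: "(y + t *\<^sub>R n) - (y \<bullet> n + t) *\<^sub>R n = y - (y \<bullet> n) *\<^sub>R n"
        by (simp add: scaleR_add_left)
      show "t = 0" using 1 2 unfolding 3 4 by linarith
    qed
    then have "negligible ?B" by (simp add: negligible_iff_null_sets null_sets_completionI)
    moreover have "openin (top_of_set (frontier S)) ?B" by (auto simp: openin_open)
    ultimately show "\<exists>U. openin (top_of_set (frontier S)) U \<and> x \<in> U \<and> negligible U"
      using x r by (intro exI[of _ ?B]) simp
  qed
  then have "frontier S \<in> null_sets lebesgue" by (simp add: negligible_iff_null_sets)
  then have "emeasure lborel (frontier S) = 0" by (auto simp: null_sets_def)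
  then show ?thesis by auto
qed

section \<open>Rounding to the scaled lattice\<close>

lemma finite_bounded_scaled_lattice:
  fixes S :: "(real ^ 'd) set"
  assumes e: "\<epsilon> > 0" and S: "bounded S"
  shows "finite (S \<inter> scaled_lattice \<epsilon>)"
proof -
  obtain r where r: "\<And>x. x \<in> S \<Longrightarrow> norm x \<le> r" using S by (auto simp: bounded_iff)
  define m where "m = \<lceil>r / \<epsilon>\<rceil>"
  have "S \<inter> scaled_lattice \<epsilon> \<subseteq> (\<lambda>f. \<epsilon> *\<^sub>R (\<chi> i. of_int (f i))) ` (PiE (UNIV :: 'd set) (\<lambda>_. {-m..m}))"
  proof
    fix x assume x: "x \<in> S \<inter> scaled_lattice \<epsilon>"
    then obtain z where z: "x = \<epsilon> *\<^sub>R z" "\<And>i. z $ i \<in> \<int>" by (auto simp: scaled_lattice_def)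
    define f where "f i = \<lfloor>z $ i\<rfloor>" for i
    have f: "z $ i = of_int (f i)" for i using z(2)[of i] by (auto simp: f_def elim: Ints_cases)
    have "f i \<in> {-m..m}" for i
    proof -
      have "\<epsilon> * \<bar>z $ i\<bar> = \<bar>x $ i\<bar>" using z(1) e by (simp add: abs_mult)
      also have "\<dots> \<le> r" using r x component_le_norm_cart[of x i] by (meson IntD1 order_trans)
      finally have "\<bar>z $ i\<bar> \<le> r / \<epsilon>" using e by (simp add: pos_le_divide_eq mult.commute)
      then have "\<bar>of_int (f i) :: real\<bar> \<le> of_int m" unfolding f m_def by linarith
      then show ?thesis by (simp add: abs_le_iff)
    qed
    then show "x \<in> (\<lambda>f. \<epsilon> *\<^sub>R (\<chi> i. of_int (f i))) ` (PiE (UNIV :: 'd set) (\<lambda>_. {-m..m}))"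
      using z(1) f by (intro image_eqI[where x=f]) (auto simp: vec_eq_iff)
  qed
  then show ?thesis by (rule finite_subset) (intro finite_imageI finite_PiE, auto)
qed

lemma countable_scaled_lattice:
  assumes "\<epsilon> > 0"
  shows "countable (scaled_lattice \<epsilon> :: (real ^ 'd) set)"
proof -
  have "scaled_lattice \<epsilon> = (\<Union>n. ball (0 :: real ^ 'd) (real n) \<inter> scaled_lattice \<epsilon>)"
    using reals_Archimedean2 by auto
  moreover have "countable (\<Union>n. ball (0 :: real ^ 'd) (real n) \<inter> scaled_lattice \<epsilon>)"
    by (rule countable_UN[OF countableI_type countable_finite[OF finite_bounded_scaled_lattice[OF assms bounded_ball]]])
  ultimately show ?thesis by (rule ssubst[where P=countable])
qed

lemma scaled_lattice_rescale:
  assumes "\<epsilon> > 0" "x \<in> scaled_lattice \<epsilon>"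
  shows "x /\<^sub>R \<epsilon> \<in> scaled_lattice 1"
proof -
  obtain z where z: "x = \<epsilon> *\<^sub>R z" "\<forall>i. z $ i \<in> \<int>" using assms(2) by (auto simp: scaled_lattice_def)
  then show ?thesis unfolding scaled_lattice_def using assms(1) by (intro CollectI exI[of _ z]) simp
qed

lemma lattice_floor_in: "\<epsilon> > 0 \<Longrightarrow> lattice_floor \<epsilon> x \<in> scaled_lattice \<epsilon>"
  unfolding lattice_floor_eq scaled_lattice_def
  by (intro CollectI exI[of _ "\<chi> i. of_int (round (x $ i / \<epsilon>))"]) (simp add: vec_eq_iff)

lemma lattice_floor_eq_iff:
  fixes x y :: "real ^ 'd"
  assumes e: "\<epsilon> > 0" and x: "x \<in> scaled_lattice \<epsilon>"
  shows "lattice_floor \<epsilon> y = x \<longleftrightarrow> (\<forall>i. x $ i - \<epsilon> / 2 \<le> y $ i \<and> y $ i < x $ i + \<epsilon> / 2)"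
proof -
  obtain z where z: "x = \<epsilon> *\<^sub>R z" "\<And>i. z $ i \<in> \<int>" using x by (auto simp: scaled_lattice_def)
  have "\<epsilon> * of_int (round (y $ i / \<epsilon>)) = x $ i \<longleftrightarrow> x $ i - \<epsilon> / 2 \<le> y $ i \<and> y $ i < x $ i + \<epsilon> / 2" for i
  proof -
    obtain n where n: "z $ i = of_int n" using z(2)[of i] by (auto elim: Ints_cases)
    have xn: "x $ i = \<epsilon> * of_int n" by (simp add: z(1) n)
    have 1: "\<epsilon> * of_int (round (y $ i / \<epsilon>)) = x $ i \<longleftrightarrow> round (y $ i / \<epsilon>) = n"
      unfolding xn using e by simp
    have 2: "round (y $ i / \<epsilon>) = n \<longleftrightarrow> of_int n - 1 / 2 \<le> y $ i / \<epsilon> \<and> y $ i / \<epsilon> < of_int n + 1 / 2"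
      unfolding round_def by linarith
    have 3: "of_int n - 1 / 2 \<le> y $ i / \<epsilon> \<longleftrightarrow> x $ i - \<epsilon> / 2 \<le> y $ i"
      unfolding pos_le_divide_eq[OF e] xn by (simp only: left_diff_distrib mult.commute[of \<epsilon>]) simp
    have 4: "y $ i / \<epsilon> < of_int n + 1 / 2 \<longleftrightarrow> y $ i < x $ i + \<epsilon> / 2"
      unfolding pos_divide_less_eq[OF e] xn by (simp only: distrib_right mult.commute[of \<epsilon>]) simp
    show ?thesis unfolding 1 2 3 4 ..
  qed
  then show ?thesis unfolding lattice_floor_eq[OF e] vec_eq_iff by simp
qed

lemma lattice_floor_dist:
  fixes y :: "real ^ 'd"
  assumes e: "\<epsilon> > 0"
  shows "dist y (lattice_floor \<epsilon> y) \<le> real CARD('d) * \<epsilon>"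
proof -
  let ?x = "lattice_floor \<epsilon> y"
  have "\<bar>(y - ?x) $ i\<bar> \<le> \<epsilon>" for i
  proof -
    have "?x $ i - \<epsilon> / 2 \<le> y $ i \<and> y $ i < ?x $ i + \<epsilon> / 2"
      using lattice_floor_eq_iff[OF e lattice_floor_in[OF e], of y y] by blast
    then show ?thesis unfolding vector_minus_component using e by linarith
  qed
  then have "(\<Sum>i\<in>UNIV. \<bar>(y - ?x) $ i\<bar>) \<le> real CARD('d) * \<epsilon>"
    by (intro sum_bounded_above) auto
  then show ?thesis unfolding dist_norm using norm_le_l1_cart[of "y - ?x"] by linarith
qed

lemma lattice_cell_measure:
  fixes x :: "real ^ 'd"
  assumes e: "\<epsilon> > 0" and x: "x \<in> scaled_lattice \<epsilon>"
  shows "{y. lattice_floor \<epsilon> y = x} \<in> sets lborel"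
    and "emeasure lborel {y. lattice_floor \<epsilon> y = x} = ennreal (\<epsilon> ^ CARD('d))"
proof -
  let ?c = "{y. lattice_floor \<epsilon> y = x}"
  let ?a = "(\<chi> i. x $ i - \<epsilon> / 2) :: real ^ 'd" and ?b = "(\<chi> i. x $ i + \<epsilon> / 2) :: real ^ 'd"
  have c: "?c = (\<Inter>i. {y. ?a $ i \<le> y $ i} \<inter> {y. y $ i < ?b $ i})"
    using lattice_floor_eq_iff[OF e x] by auto
  have "?c \<in> sets borel"
    unfolding c by (intro sets.countable_INT'' sets.Int borel_closed borel_open closed_Collect_le open_Collect_less continuous_intros) auto
  then show s: "?c \<in> sets lborel" by simp
  have ab: "?a \<bullet> b \<le> ?b \<bullet> b" if "b \<in> Basis" for b
    using that e by (auto simp: Basis_vec_def inner_axis)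
  have pr: "(\<Prod>b\<in>Basis. (?b - ?a) \<bullet> b) = \<epsilon> ^ CARD('d)"
  proof -
    have "(?b - ?a) \<bullet> b = \<epsilon>" if "b \<in> Basis" for b
      using that by (auto simp: Basis_vec_def inner_axis)
    then show ?thesis by (simp del: inner_diff_left)
  qed
  have "box ?a ?b \<subseteq> ?c" unfolding c by (auto simp: mem_box_cart less_imp_le)
  then have 1: "emeasure lborel (box ?a ?b) \<le> emeasure lborel ?c" using s by (rule emeasure_mono)
  have "?c \<subseteq> cbox ?a ?b" unfolding c by (auto simp: mem_box_cart less_imp_le)
  then have 2: "emeasure lborel ?c \<le> emeasure lborel (cbox ?a ?b)" by (rule emeasure_mono) simp
  show "emeasure lborel ?c = ennreal (\<epsilon> ^ CARD('d))"
    using 1 2 ab pr by (simp add: emeasure_lborel_cbox_eq emeasure_lborel_box_eq)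
qed

lemma sampled_set_measurable:
  fixes S :: "(real ^ 'd) set"
  assumes e: "\<epsilon> > 0" and S: "bounded S"
  shows "{y. lattice_floor \<epsilon> y \<in> S} \<in> sets lborel"
proof -
  have "{y. lattice_floor \<epsilon> y \<in> S} = (\<Union>x\<in>S \<inter> scaled_lattice \<epsilon>. {y. lattice_floor \<epsilon> y = x})"
    using lattice_floor_in[OF e] by auto
  moreover have "(\<Union>x\<in>S \<inter> scaled_lattice \<epsilon>. {y. lattice_floor \<epsilon> y = x}) \<in> sets lborel"
    by (intro sets.finite_UN finite_bounded_scaled_lattice[OF e S] lattice_cell_measure(1)[OF e]) simp
  ultimately show ?thesis by (rule ssubst[where P="\<lambda>s. s \<in> sets lborel"])
qed

lemma eventually_at_right_mult_less:
  assumes "(\<delta>::real) > 0"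
  shows "\<forall>\<^sub>F \<epsilon> in at_right 0. 0 < \<epsilon> \<and> \<epsilon> < 1 \<and> D * \<epsilon> < \<delta>"
proof -
  have "((\<lambda>\<epsilon>. D * \<epsilon>) \<longlongrightarrow> D * 0) (at_right 0)" by (intro tendsto_intros)
  then have "\<forall>\<^sub>F \<epsilon> in at_right 0. D * \<epsilon> < \<delta>" by (rule order_tendstoD(2)) (use assms in simp)
  moreover have "\<forall>\<^sub>F \<epsilon> in at_right (0::real). 0 < \<epsilon> \<and> \<epsilon> < 1"
    using eventually_at_right_real[of 0 1] by simp
  ultimately show ?thesis by eventually_elim auto
qed

lemma bounded_infdist_le:
  assumes "bounded (Q :: 'a::metric_space set)" "Q \<noteq> {}"
  shows "bounded {x. infdist x Q \<le> r}"
proof -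
  obtain a where a: "a \<in> Q" using assms(2) by blast
  obtain b where b: "\<And>x. x \<in> Q \<Longrightarrow> dist a x \<le> b" using assms(1) unfolding bounded_any_center[of _ a] by blast
  have "dist a x \<le> b + (r + 1)" if x: "infdist x Q \<le> r" for x
  proof -
    have "infdist x Q < r + 1" using x by simp
    then obtain q where q: "q \<in> Q" "dist x q < r + 1"
      unfolding infdist_notempty[OF assms(2)] using assms(2)
      by (subst (asm) cINF_less_iff) auto
    show ?thesis using dist_triangle[of a x q] b[OF q(1)] q(2) by (simp add: dist_commute)
  qed
  then show ?thesis unfolding bounded_any_center[of _ a] by blast
qed

lemma infdist_sampled_le:
  fixes Q :: "(real ^ 'd) set"
  assumes e: "\<epsilon> > 0" and Qp: "Qp \<subseteq> {x. infdist x Q \<le> c * \<epsilon>}" and y: "lattice_floor \<epsilon> y \<in> Qp"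
  shows "infdist y Q \<le> (c + real CARD('d)) * \<epsilon>"
proof -
  have "infdist y Q \<le> infdist (lattice_floor \<epsilon> y) Q + dist y (lattice_floor \<epsilon> y)" by (rule infdist_triangle)
  also have "\<dots> \<le> c * \<epsilon> + real CARD('d) * \<epsilon>"
    using Qp y lattice_floor_dist[OF e, of y] by (intro add_mono) auto
  finally show ?thesis by (simp add: distrib_right)
qed

text \<open>Rounding moves a point by at most a multiple of \<open>\<epsilon>\<close>, and \<open>Qp \<epsilon>\<close> differs from \<open>Q\<close> by a multiple of \<open>\<epsilon>\<close>;
  a point off the frontier has positive distance either to the complement or to the domain.\<close>

lemma sampled_set_eventually_iff:
  fixes Q :: "(real ^ 'd) set"
  assumes Q: "open Q" "Q \<noteq> {}" and y: "y \<notin> frontier Q"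
    and Qp: "\<And>\<epsilon>. \<epsilon> > 0 \<Longrightarrow> Q \<subseteq> Qp \<epsilon>" "\<And>\<epsilon>. \<epsilon> > 0 \<Longrightarrow> Qp \<epsilon> \<subseteq> {x. infdist x Q \<le> c * \<epsilon>}"
  shows "\<forall>\<^sub>F \<epsilon> in at_right 0. lattice_floor \<epsilon> y \<in> Qp \<epsilon> \<longleftrightarrow> y \<in> Q"
proof (cases "y \<in> Q")
  case True
  then obtain r where r: "r > 0" "ball y r \<subseteq> Q" using Q(1) by (auto simp: open_contains_ball)
  from eventually_at_right_mult_less[OF r(1), of "real CARD('d)"] show ?thesis
  proof eventually_elim
    case (elim \<epsilon>)
    then have "dist y (lattice_floor \<epsilon> y) < r" using lattice_floor_dist[of \<epsilon> y] by linarith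
    then have "lattice_floor \<epsilon> y \<in> Q" using r(2) by (auto simp: mem_ball)
    then show ?case using Qp(1)[of \<epsilon>] elim True by blast
  qed
next
  case False
  then have "y \<notin> closure Q" using y Q(1) by (simp add: frontier_def interior_open)
  then have "infdist y Q > 0"
    using in_closure_iff_infdist_zero[OF Q(2), of y] infdist_nonneg[of y Q] by linarith
  from eventually_at_right_mult_less[OF this, of "c + real CARD('d)"] show ?thesis
  proof eventually_elim
    case (elim \<epsilon>)
    have "lattice_floor \<epsilon> y \<notin> Qp \<epsilon>"
    proof
      assume "lattice_floor \<epsilon> y \<in> Qp \<epsilon>"
      from infdist_sampled_le[OF _ Qp(2) this] elim show False by linarith
    qed
    then show ?case using False by blast
  qed
qed

text \<open>Points at distance at least \<open>1 / (m + 1)\<close> from the complement are rounded into \<open>Q\<close> as soon as \<open>\<epsilon>\<close> is small,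
  uniformly on \<open>K m\<close>.\<close>

lemma ex_interior_exhaustion:
  fixes Q :: "(real ^ 'd) set"
  assumes Q: "open Q" "bounded Q" and Qp: "\<And>\<epsilon>. \<epsilon> > 0 \<Longrightarrow> Q \<subseteq> Qp \<epsilon>"
  obtains K :: "nat \<Rightarrow> (real ^ 'd) set" where "\<And>m. K m \<in> sets lborel" "\<And>m. K m \<subseteq> Q"
    "\<And>y. y \<in> Q \<Longrightarrow> \<forall>\<^sub>F m in sequentially. y \<in> K m"
    "\<And>m. \<forall>\<^sub>F \<epsilon> in at_right 0. K m \<subseteq> {y. lattice_floor \<epsilon> y \<in> Qp \<epsilon>}"
proof -
  \<comment> \<open>If the complement were empty, \<open>infdist\<close> would be \<open>0\<close> by default and the sets below would be empty.\<close>
  have ne: "- Q \<noteq> {}" using Q(2) not_bounded_UNIV by (metis Compl_eq_Diff_UNIV Diff_eq_empty_iff top.extremum_uniqueI)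
  define K where "K m = Q \<inter> {y. inverse (real (Suc m)) \<le> infdist y (- Q)}" for m
  show ?thesis
  proof (rule that)
    fix m
    have "closed {y. inverse (real (Suc m)) \<le> infdist y (- Q)}"
      by (intro closed_Collect_le continuous_on_const continuous_on_infdist continuous_on_id)
    then show "K m \<in> sets lborel" unfolding K_def using Q(1) by simp
    show "K m \<subseteq> Q" by (simp add: K_def)
    have "inverse (real (Suc m)) > 0" by simp
    from eventually_at_right_mult_less[OF this, of "real CARD('d)"]
    show "\<forall>\<^sub>F \<epsilon> in at_right 0. K m \<subseteq> {y. lattice_floor \<epsilon> y \<in> Qp \<epsilon>}"
    proof eventually_elim
      case (elim \<epsilon>)
      show ?case
      proof
        fix y assume y: "y \<in> K m"
        have "dist y (lattice_floor \<epsilon> y) < inverse (real (Suc m))"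
          using lattice_floor_dist[of \<epsilon> y] elim by linarith
        then have "\<not> infdist y (- Q) \<le> dist y (lattice_floor \<epsilon> y)" using y unfolding K_def by simp
        then have "lattice_floor \<epsilon> y \<in> Q" using infdist_le[of "lattice_floor \<epsilon> y" "- Q" y] by blast
        then show "y \<in> {y. lattice_floor \<epsilon> y \<in> Qp \<epsilon>}" using Qp elim by blast
      qed
    qed
  next
    fix y assume y: "y \<in> Q"
    have "infdist y (- Q) > 0" using Q(1) ne y by (intro infdist_pos_not_in_closed) (auto simp: closed_Compl)
    then have "\<forall>\<^sub>F m in sequentially. inverse (real (Suc m)) < infdist y (- Q)"
      by (rule order_tendstoD(2)[OF LIMSEQ_inverse_real_of_nat])
    then show "\<forall>\<^sub>F m in sequentially. y \<in> K m"
      by eventually_elim (use y in \<open>simp add: K_def\<close>)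
  qed
qed

section \<open>The lattice measure\<close>

lemma lattice_measure_density:
  "lattice_measure \<epsilon> = density (count_space (scaled_lattice \<epsilon> :: (real ^ 'd) set)) (\<lambda>_. ennreal (\<epsilon> ^ CARD('d)))"
proof (rule measure_eqI)
  show "sets (lattice_measure \<epsilon>) = sets (density (count_space (scaled_lattice \<epsilon> :: (real ^ 'd) set)) (\<lambda>_. ennreal (\<epsilon> ^ CARD('d))))"
    by (simp add: lattice_measure_def)
next
  fix A :: "(real ^ 'd) set"
  assume "A \<in> sets (lattice_measure \<epsilon>)"
  then have "A \<in> sets (count_space (scaled_lattice \<epsilon>))" by (simp add: lattice_measure_def)
  then show "emeasure (lattice_measure \<epsilon>) A = emeasure (density (count_space (scaled_lattice \<epsilon>)) (\<lambda>_. ennreal (\<epsilon> ^ CARD('d)))) A"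
    unfolding lattice_measure_def emeasure_scale_measure by (rule emeasure_density_const[symmetric])
qed

lemma sigma_finite_lattice_measure:
  assumes e: "\<epsilon> > 0"
  shows "sigma_finite_measure (lattice_measure \<epsilon> :: (real ^ 'd) measure)"
proof
  let ?L = "scaled_lattice \<epsilon> :: (real ^ 'd) set"
  have "countable ((\<lambda>x. {x}) ` ?L)" by (intro countable_image countable_scaled_lattice e)
  moreover have "(\<lambda>x. {x}) ` ?L \<subseteq> sets (lattice_measure \<epsilon>)" by (auto simp: lattice_measure_def)
  moreover have "\<Union> ((\<lambda>x. {x}) ` ?L) = space (lattice_measure \<epsilon>)"
    by (auto simp: lattice_measure_def space_scale_measure)
  moreover have "\<forall>a\<in>(\<lambda>x. {x}) ` ?L. emeasure (lattice_measure \<epsilon>) a \<noteq> \<infinity>"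
    by (auto simp: lattice_measure_def)
  ultimately show "\<exists>A. countable A \<and> A \<subseteq> sets (lattice_measure \<epsilon> :: (real ^ 'd) measure) \<and> \<Union> A = space (lattice_measure \<epsilon>) \<and>
     (\<forall>a\<in>A. emeasure (lattice_measure \<epsilon>) a \<noteq> \<infinity>)" by blast
qed

text \<open>The sections are integrable at almost every lattice point by Fubini, hence at every one, as each point has positive mass.\<close>

lemma Lp_lattice_section:
  fixes f :: "'w \<times> (real ^ 'd) \<Rightarrow> real"
  assumes M: "sigma_finite_measure M" and e: "\<epsilon> > 0"
    and f: "f \<in> Lp (M \<Otimes>\<^sub>M lattice_measure \<epsilon>) p" and x: "x \<in> scaled_lattice \<epsilon>"
  shows "(\<lambda>\<omega>. f (\<omega>, x)) \<in> Lp M p"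
proof -
  let ?L = "lattice_measure \<epsilon> :: (real ^ 'd) measure"
  have xs: "x \<in> space ?L" using x by (simp add: lattice_measure_def space_scale_measure)
  have "(\<lambda>\<omega>. (\<omega>, x)) \<in> M \<rightarrow>\<^sub>M M \<Otimes>\<^sub>M ?L" using xs by simp
  moreover have "f \<in> borel_measurable (M \<Otimes>\<^sub>M ?L)" using f by (simp add: Lp_def)
  ultimately have m: "(\<lambda>\<omega>. f (\<omega>, x)) \<in> borel_measurable M" by (rule measurable_compose)
  interpret P: pair_sigma_finite M ?L
    using M sigma_finite_lattice_measure[OF e] by (rule pair_sigma_finite.intro)
  interpret P': pair_sigma_finite ?L M
    using sigma_finite_lattice_measure[OF e] M by (rule pair_sigma_finite.intro)
  have "integrable (?L \<Otimes>\<^sub>M M) (\<lambda>(y, \<omega>). \<bar>f (\<omega>, y)\<bar> powr p)"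
    using f P.integrable_product_swap[of "\<lambda>z. \<bar>f z\<bar> powr p"] by (simp add: Lp_def)
  then have "AE y in ?L. integrable M (\<lambda>\<omega>. \<bar>f (\<omega>, y)\<bar> powr p)"
    using P'.AE_integrable_fst' by force
  then have "integrable M (\<lambda>\<omega>. \<bar>f (\<omega>, x)\<bar> powr p)"
    using x e unfolding lattice_measure_density by (simp add: AE_density AE_count_space)
  then show ?thesis using m by (simp add: Lp_def)
qed

lemma set_integral_lattice_measure:
  fixes f :: "real ^ 'd \<Rightarrow> real"
  assumes e: "\<epsilon> > 0" and fin: "finite (S \<inter> scaled_lattice \<epsilon>)"
  shows "(LINT x:(S \<inter> scaled_lattice \<epsilon>)|lattice_measure \<epsilon>. f x) = (\<Sum>x\<in>S \<inter> scaled_lattice \<epsilon>. \<epsilon> ^ CARD('d) * f x)"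
proof -
  let ?L = "scaled_lattice \<epsilon> :: (real ^ 'd) set" and ?S = "S \<inter> scaled_lattice \<epsilon>"
  let ?h = "\<lambda>x. \<epsilon> ^ CARD('d) * (indicator ?S x * f x)"
  have "(LINT x:?S|lattice_measure \<epsilon>. f x) = (\<integral>x. ?h x \<partial>count_space ?L)"
    unfolding lattice_measure_density set_lebesgue_integral_def
    using e by (subst integral_density) auto
  also have "\<dots> = (\<Sum>x | x \<in> ?L \<and> ?h x \<noteq> 0. ?h x)"
    by (rule lebesgue_integral_count_space_finite_support, rule finite_subset[OF _ fin]) (auto simp: indicator_def)
  also have "\<dots> = (\<Sum>x\<in>?S. ?h x)"
    by (rule sum.mono_neutral_left[OF fin]) (auto simp: indicator_def)
  also have "\<dots> = (\<Sum>x\<in>?S. \<epsilon> ^ CARD('d) * f x)"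
    by (rule sum.cong) auto
  finally show ?thesis .
qed

section \<open>Product measures\<close>

lemma AE_fst_pair:
  assumes N: "sigma_finite_measure N" and P: "AE x in M. P x"
  shows "AE z in M \<Otimes>\<^sub>M N. P (fst z)"
proof -
  interpret N: sigma_finite_measure N by (rule N)
  obtain A where A: "A \<in> null_sets M" "{x \<in> space M. \<not> P x} \<subseteq> A"
    using P by (auto elim: AE_E3 simp: eventually_ae_filter)
  have "A \<times> space N \<in> null_sets (M \<Otimes>\<^sub>M N)" using A(1) by (intro N.times_in_null_sets1) auto
  then show ?thesis by (rule AE_I') (use A(2) in \<open>auto simp: space_pair_measure\<close>)
qed

lemma AE_snd_pair:
  assumes N: "sigma_finite_measure N" and P: "AE y in N. P y"
  shows "AE z in M \<Otimes>\<^sub>M N. P (snd z)"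
proof -
  interpret N: sigma_finite_measure N by (rule N)
  obtain A where A: "A \<in> null_sets N" "{y \<in> space N. \<not> P y} \<subseteq> A"
    using P by (auto simp: eventually_ae_filter)
  have "space M \<times> A \<in> null_sets (M \<Otimes>\<^sub>M N)" using A(1) by (intro N.times_in_null_sets2) auto
  then show ?thesis by (rule AE_I') (use A(2) in \<open>auto simp: space_pair_measure\<close>)
qed

lemma integral_pair_indicator_mult:
  fixes G :: "'w \<Rightarrow> real" and B :: "'b set"
  assumes M: "sigma_finite_measure M" and N: "sigma_finite_measure N"
    and G: "integrable M G" and B: "B \<in> sets N" "emeasure N B < \<infinity>"
  shows "integrable (M \<Otimes>\<^sub>M N) (\<lambda>z. indicator B (snd z) * G (fst z))"
    and "(\<integral>z. indicator B (snd z) * G (fst z) \<partial>(M \<Otimes>\<^sub>M N)) = measure N B * (\<integral>\<omega>. G \<omega> \<partial>M)"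
proof -
  interpret P: pair_sigma_finite M N using M N by (rule pair_sigma_finite.intro)
  have iB: "integrable N (indicator B :: _ \<Rightarrow> real)" using B by simp
  have sB: "(\<integral>y. indicator B y \<partial>N) = measure N B"
    using sets.sets_into_space[OF B(1)] by (simp add: Int_absorb2)
  have m: "(\<lambda>z. indicator B (snd z) * G (fst z)) \<in> borel_measurable (M \<Otimes>\<^sub>M N)"
    by (intro borel_measurable_times measurable_compose[OF measurable_snd borel_measurable_indicator[OF B(1)]]
        measurable_compose[OF measurable_fst borel_measurable_integrable[OF G]])
  have n: "(\<integral>y. norm (indicator B (snd (\<omega>, y)) * G (fst (\<omega>, y))) \<partial>N) = measure N B * \<bar>G \<omega>\<bar>" for \<omega>
  proof -
    have "(\<integral>y. norm (indicator B (snd (\<omega>, y)) * G (fst (\<omega>, y))) \<partial>N) = (\<integral>y. indicator B y * \<bar>G \<omega>\<bar> \<partial>N)"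
      by (simp add: abs_mult)
    also have "\<dots> = measure N B * \<bar>G \<omega>\<bar>" by (simp only: integral_mult_left_zero sB)
    finally show ?thesis .
  qed
  show i: "integrable (M \<Otimes>\<^sub>M N) (\<lambda>z. indicator B (snd z) * G (fst z))"
  proof (rule P.Fubini_integrable[OF m])
    show "integrable M (\<lambda>\<omega>. \<integral>y. norm (indicator B (snd (\<omega>, y)) * G (fst (\<omega>, y))) \<partial>N)"
      unfolding n by (intro integrable_mult_right integrable_abs G)
    show "AE \<omega> in M. integrable N (\<lambda>y. indicator B (snd (\<omega>, y)) * G (fst (\<omega>, y)))"
      by (intro AE_I2) (simp add: iB)
  qed
  have "(\<integral>z. indicator B (snd z) * G (fst z) \<partial>(M \<Otimes>\<^sub>M N)) = (\<integral>\<omega>. \<integral>y. indicator B y * G \<omega> \<partial>N \<partial>M)"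
    using P.integral_fst'[OF i] by simp
  also have "\<dots> = measure N B * (\<integral>\<omega>. G \<omega> \<partial>M)"
    by (simp only: integral_mult_left_zero sB integral_mult_right_zero)
  finally show "(\<integral>z. indicator B (snd z) * G (fst z) \<partial>(M \<Otimes>\<^sub>M N)) = measure N B * (\<integral>\<omega>. G \<omega> \<partial>M)" .
qed

lemma convex_integrand_fst:
  assumes V: "convex_integrand M V p C" and N: "sigma_finite_measure N"
  shows "convex_integrand (M \<Otimes>\<^sub>M N) (\<lambda>z. V (fst z)) p C"
proof -
  interpret V: convex_integrand M V p C by (rule V)
  show ?thesis
  proof
    show "1 < p" "0 < C" by (rule V.p V.C)+
    have "(\<lambda>(z, F). (fst z, F)) \<in> (M \<Otimes>\<^sub>M N) \<Otimes>\<^sub>M borel \<rightarrow>\<^sub>M M \<Otimes>\<^sub>M borel" by measurable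
    from measurable_compose[OF this V.joint_measurable]
    show "(\<lambda>(z, F). V (fst z) F) \<in> borel_measurable ((M \<Otimes>\<^sub>M N) \<Otimes>\<^sub>M borel)"
      by (simp add: split_beta)
    show "AE z in M \<Otimes>\<^sub>M N. convex_on UNIV (V (fst z))"
      by (rule AE_fst_pair[OF N V.AE_convex])
    show "AE z in M \<Otimes>\<^sub>M N. \<forall>F. 1 / C * norm F powr p - C \<le> V (fst z) F \<and> V (fst z) F \<le> C * (norm F powr p + 1)"
      by (rule AE_fst_pair[OF N V.AE_growth])
  qed
qed

section \<open>Unfolding the energy\<close>

text \<open>The axioms speak of forward images. Since \<open>T (- x)\<close> inverts \<open>T x\<close> on the space, these are the preimages
  under the opposite shift, which yields the image measure.\<close>

lemma measure_preserving_shift: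
  assumes T: "measure_preserving_system M T" and x: "x \<in> scaled_lattice 1"
  shows "T x \<in> M \<rightarrow>\<^sub>M M" and "\<And>\<omega>. \<omega> \<in> space M \<Longrightarrow> T (- x) (T x \<omega>) = \<omega>" and "distr M M (T x) = M"
proof -
  have mx: "- x \<in> scaled_lattice 1" if "x \<in> scaled_lattice 1" for x :: "real ^ 'd"
  proof -
    have "\<forall>i. (- x) $ i \<in> \<int>" using that by (auto simp: scaled_lattice_def)
    then show ?thesis unfolding scaled_lattice_def by (intro CollectI exI[of _ "- x"]) simp
  qed
  have meas: "T y \<in> M \<rightarrow>\<^sub>M M" if "y \<in> scaled_lattice 1" for y
    using T that unfolding measure_preserving_system_def by blast
  have inv: "T (- y) (T y \<omega>) = \<omega>" if "y \<in> scaled_lattice 1" "\<omega> \<in> space M" for y \<omega>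
  proof -
    have "T (- y) (T y \<omega>) = T (- y + y) \<omega>"
      using T that mx[OF that(1)] unfolding measure_preserving_system_def by metis
    also have "\<dots> = \<omega>" using T that(2) unfolding measure_preserving_system_def by simp
    finally show ?thesis .
  qed
  show m: "T x \<in> M \<rightarrow>\<^sub>M M" using meas[OF x] .
  show "\<And>\<omega>. \<omega> \<in> space M \<Longrightarrow> T (- x) (T x \<omega>) = \<omega>" using inv[OF x] .
  show "distr M M (T x) = M"
  proof (rule measure_eqI)
    fix A assume "A \<in> sets (distr M M (T x))"
    then have A: "A \<in> sets M" by simp
    have AM: "A \<subseteq> space M" using sets.sets_into_space[OF A] .
    have "T x -` A \<inter> space M = T (- x) ` A"
    proof (intro set_eqI iffI)
      fix \<omega> assume w: "\<omega> \<in> T x -` A \<inter> space M"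
      then have "\<omega> = T (- x) (T x \<omega>)" using inv[OF x] by simp
      then show "\<omega> \<in> T (- x) ` A" using w by blast
    next
      fix \<omega> assume "\<omega> \<in> T (- x) ` A"
      then obtain a where a: "a \<in> A" "\<omega> = T (- x) a" by blast
      have "a \<in> space M" using a(1) AM by blast
      moreover have "T x (T (- x) a) = a" using inv[OF mx[OF x] \<open>a \<in> space M\<close>] by simp
      ultimately show "\<omega> \<in> T x -` A \<inter> space M"
        using a measurable_space[OF meas[OF mx[OF x]]] by simp
    qed
    then show "emeasure (distr M M (T x)) A = emeasure M A"
      using T mx[OF x] A m unfolding measure_preserving_system_def by (simp add: emeasure_distr)
  qed simp
qed

lemma Lp_shift:
  assumes T: "measure_preserving_system M T" and x: "x \<in> scaled_lattice 1" and f: "f \<in> Lp M p"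
  shows "(\<lambda>\<omega>. f (T x \<omega>)) \<in> Lp M p"
proof -
  note ms = measure_preserving_shift[OF T x]
  have fm: "f \<in> borel_measurable M" and fi: "integrable (distr M M (T x)) (\<lambda>\<omega>. \<bar>f \<omega>\<bar> powr p)"
    using f unfolding ms(3) by (auto simp: Lp_def)
  show ?thesis unfolding Lp_def
    using measurable_compose[OF ms(1) fm] integrable_distr[OF ms(1) fi] by simp
qed

text \<open>Shifting the probability space by \<open>x / \<epsilon>\<close> at the lattice point \<open>x\<close> moves the oscillation from the integrand
  into the argument; this preserves expectations. The factor \<open>\<epsilon>\<close> to the power \<open>d\<close> is the volume of the cell
  that is rounded to \<open>x\<close>, and the finite sum over lattice points becomes an integral over the union of these cells.\<close>

lemma energy_unfolding:
  fixes T :: "real ^ 'd \<Rightarrow> 'w \<Rightarrow> 'w" and V :: "'w \<Rightarrow> real ^ 'k \<Rightarrow> real"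
  assumes M: "prob_space M" and T: "measure_preserving_system M T"
    and V: "convex_integrand M V p C"
    and e: "\<epsilon> > 0" and S: "bounded S" and u: "u \<in> Lp_vec (M \<Otimes>\<^sub>M lattice_measure \<epsilon>) p"
  shows "(\<integral>\<omega>. (LINT x:(S \<inter> scaled_lattice \<epsilon>)|lattice_measure \<epsilon>. V (T (x /\<^sub>R \<epsilon>) \<omega>) (u (\<omega>, x))) \<partial>M)
    = (\<integral>z. indicator (space M \<times> {y. lattice_floor \<epsilon> y \<in> S}) z * V (fst z) (unfolding_op T \<epsilon> u z) \<partial>(M \<Otimes>\<^sub>M lborel))"
proof -
  interpret V: convex_integrand M V p C by (rule V)
  interpret M: prob_space M by (rule M)
  let ?S = "S \<inter> scaled_lattice \<epsilon>"
  let ?c = "\<lambda>x :: real ^ 'd. {y. lattice_floor \<epsilon> y = x}"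
  have fin: "finite ?S" by (rule finite_bounded_scaled_lattice[OF e S])
  define G where "G x \<omega> = V \<omega> (u (T (- x /\<^sub>R \<epsilon>) \<omega>, x))" for x \<omega>
  have resc: "x /\<^sub>R \<epsilon> \<in> scaled_lattice 1" "- x /\<^sub>R \<epsilon> \<in> scaled_lattice 1" if x: "x \<in> ?S" for x
  proof -
    show "x /\<^sub>R \<epsilon> \<in> scaled_lattice 1" using x e by (auto intro: scaled_lattice_rescale)
    have "- x \<in> scaled_lattice \<epsilon>"
    proof -
      obtain z where z: "x = \<epsilon> *\<^sub>R z" "\<forall>i. z $ i \<in> \<int>" using x by (auto simp: scaled_lattice_def)
      then show ?thesis unfolding scaled_lattice_def by (intro CollectI exI[of _ "- z"]) simp
    qed
    then show "- x /\<^sub>R \<epsilon> \<in> scaled_lattice 1" using e by (rule scaled_lattice_rescale[rotated])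
  qed
  have iG: "integrable M (G x)" if x: "x \<in> ?S" for x
  proof -
    have "(\<lambda>\<omega>. u (T (- x /\<^sub>R \<epsilon>) \<omega>, x)) \<in> Lp_vec M p"
      unfolding Lp_vec_def
    proof (intro CollectI allI)
      fix i
      have "(\<lambda>\<omega>. u (\<omega>, x) $ i) \<in> Lp M p"
        by (rule Lp_lattice_section[OF M.sigma_finite_measure_axioms e]) (use u x in \<open>auto simp: Lp_vec_def\<close>)
      from Lp_shift[OF T resc(2)[OF x] this] show "(\<lambda>\<omega>. u (T (- x /\<^sub>R \<epsilon>) \<omega>, x) $ i) \<in> Lp M p" .
    qed
    from V.integrable_superposition[OF this sets.top] have "integrable M (\<lambda>\<omega>. indicator (space M) \<omega> * G x \<omega>)"
      unfolding G_def by (simp add: M.emeasure_space_1)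
    then show ?thesis by (rule Bochner_Integration.integrable_cong[OF refl, THEN iffD1, rotated]) simp
  qed
  have shift: "integrable M (\<lambda>\<omega>. G x (T (x /\<^sub>R \<epsilon>) \<omega>))" "(\<integral>\<omega>. G x (T (x /\<^sub>R \<epsilon>) \<omega>) \<partial>M) = (\<integral>\<omega>. G x \<omega> \<partial>M)"
    if x: "x \<in> ?S" for x
  proof -
    note ms = measure_preserving_shift[OF T resc(1)[OF x]]
    show "integrable M (\<lambda>\<omega>. G x (T (x /\<^sub>R \<epsilon>) \<omega>))"
      by (rule integrable_distr[OF ms(1)]) (simp add: ms(3) iG[OF x])
    show "(\<integral>\<omega>. G x (T (x /\<^sub>R \<epsilon>) \<omega>) \<partial>M) = (\<integral>\<omega>. G x \<omega> \<partial>M)"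
      using integral_distr[OF ms(1) borel_measurable_integrable[OF iG[OF x]]] unfolding ms(3) by simp
  qed
  have G_shift: "V (T (x /\<^sub>R \<epsilon>) \<omega>) (u (\<omega>, x)) = G x (T (x /\<^sub>R \<epsilon>) \<omega>)" if x: "x \<in> ?S" and w: "\<omega> \<in> space M" for x \<omega>
    using measure_preserving_shift(2)[OF T resc(1)[OF x] w] unfolding G_def by simp
  have "(\<integral>\<omega>. (LINT x:?S|lattice_measure \<epsilon>. V (T (x /\<^sub>R \<epsilon>) \<omega>) (u (\<omega>, x))) \<partial>M)
    = (\<integral>\<omega>. (\<Sum>x\<in>?S. \<epsilon> ^ CARD('d) * G x (T (x /\<^sub>R \<epsilon>) \<omega>)) \<partial>M)"
    unfolding set_integral_lattice_measure[OF e fin]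
    by (intro Bochner_Integration.integral_cong refl sum.cong) (simp only: G_shift)
  also have "\<dots> = (\<Sum>x\<in>?S. \<epsilon> ^ CARD('d) * (\<integral>\<omega>. G x \<omega> \<partial>M))"
    by (subst Bochner_Integration.integral_sum[OF integrable_mult_right[OF shift(1)]])
      (simp_all only: shift(2) integral_mult_right_zero cong: sum.cong)
  also have "\<dots> = (\<Sum>x\<in>?S. (\<integral>z. indicator (?c x) (snd z) * G x (fst z) \<partial>(M \<Otimes>\<^sub>M lborel)))"
  proof (rule sum.cong[OF refl])
    fix x assume x: "x \<in> ?S"
    then have xl: "x \<in> scaled_lattice \<epsilon>" by blast
    note c = lattice_cell_measure[OF e xl]
    have "measure lborel (?c x) = \<epsilon> ^ CARD('d)" using c(2) e by (simp add: measure_def)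
    moreover have "emeasure lborel (?c x) < \<infinity>" unfolding c(2) by simp
    ultimately show "\<epsilon> ^ CARD('d) * (\<integral>\<omega>. G x \<omega> \<partial>M) = (\<integral>z. indicator (?c x) (snd z) * G x (fst z) \<partial>(M \<Otimes>\<^sub>M lborel))"
      using integral_pair_indicator_mult(2)[OF M.sigma_finite_measure_axioms lborel.sigma_finite_measure_axioms iG[OF x] c(1)]
      by simp
  qed
  also have "\<dots> = (\<integral>z. (\<Sum>x\<in>?S. indicator (?c x) (snd z) * G x (fst z)) \<partial>(M \<Otimes>\<^sub>M lborel))"
  proof (rule Bochner_Integration.integral_sum[symmetric])
    fix x assume x: "x \<in> ?S"
    then have xl: "x \<in> scaled_lattice \<epsilon>" by blast
    note c = lattice_cell_measure[OF e xl]
    have "emeasure lborel (?c x) < \<infinity>" unfolding c(2) by simp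
    then show "integrable (M \<Otimes>\<^sub>M lborel) (\<lambda>z. indicator (?c x) (snd z) * G x (fst z))"
      by (rule integral_pair_indicator_mult(1)[OF M.sigma_finite_measure_axioms lborel.sigma_finite_measure_axioms iG[OF x] c(1)])
  qed
  also have "\<dots> = (\<integral>z. indicator (space M \<times> {y. lattice_floor \<epsilon> y \<in> S}) z * V (fst z) (unfolding_op T \<epsilon> u z) \<partial>(M \<Otimes>\<^sub>M lborel))"
  proof (rule Bochner_Integration.integral_cong[OF refl])
    fix z assume "z \<in> space (M \<Otimes>\<^sub>M (lborel :: (real ^ 'd) measure))"
    then obtain \<omega> y where z: "z = (\<omega>, y)" "\<omega> \<in> space M" by (auto simp: space_pair_measure)
    have W: "V (fst z) (unfolding_op T \<epsilon> u z) = G (lattice_floor \<epsilon> y) \<omega>"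
      by (simp add: z(1) G_def unfolding_op_def interpolation_def discrete_unfolding_def)
    have "(\<Sum>x\<in>?S. indicator (?c x) (snd z) * G x (fst z)) = (\<Sum>x\<in>?S. if x = lattice_floor \<epsilon> y then G x \<omega> else 0)"
      by (rule sum.cong) (auto simp: z(1) indicator_def)
    also have "\<dots> = (if lattice_floor \<epsilon> y \<in> ?S then G (lattice_floor \<epsilon> y) \<omega> else 0)"
      using fin by (rule sum.delta)
    also have "\<dots> = indicator (space M \<times> {y. lattice_floor \<epsilon> y \<in> S}) z * G (lattice_floor \<epsilon> y) \<omega>"
      using z lattice_floor_in[OF e, of y] by (simp add: indicator_def)
    finally show "(\<Sum>x\<in>?S. indicator (?c x) (snd z) * G x (fst z))
      = indicator (space M \<times> {y. lattice_floor \<epsilon> y \<in> S}) z * V (fst z) (unfolding_op T \<epsilon> u z)"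
      unfolding W .
  qed
  finally show ?thesis .
qed

section \<open>Convergence of the energies\<close>

theorem proposition3p3:
  fixes M :: "'w measure"
    and T :: "real ^ 'd \<Rightarrow> 'w \<Rightarrow> 'w"
    and p :: real
    and V :: "'w \<Rightarrow> real ^ 'k \<Rightarrow> real"
    and Q :: "(real ^ 'd) set"
    and Qp :: "real \<Rightarrow> (real ^ 'd) set"
    and u :: "real \<Rightarrow> 'w \<times> (real ^ 'd) \<Rightarrow> real ^ 'k"
    and U :: "'w \<times> (real ^ 'd) \<Rightarrow> real ^ 'k"
  assumes "1 < p"
    and "prob_space M" and "separable_measure M"
    and "measure_preserving_system M T"
    and "(\<lambda>(\<omega>, F). V \<omega> F) \<in> borel_measurable (M \<Otimes>\<^sub>M borel)"
    and "AE \<omega> in M. convex_on UNIV (V \<omega>)"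
    and "\<exists>C>0. AE \<omega> in M. \<forall>F. 1 / C * norm F powr p - C \<le> V \<omega> F \<and>
                                 V \<omega> F \<le> C * (norm F powr p + 1)"
    and "bounded_lipschitz_domain Q"
    and "\<forall>\<epsilon>>0. bounded_lipschitz_domain (Qp \<epsilon>)"
    and "\<exists>C>0. \<forall>\<epsilon>>0. Q \<subseteq> Qp \<epsilon> \<and> Qp \<epsilon> \<subseteq> {x. infdist x Q \<le> C * \<epsilon>}"
    and "\<forall>\<epsilon>>0. u \<epsilon> \<in> Lp_vec (M \<Otimes>\<^sub>M lattice_measure \<epsilon>) p"
    and "U \<in> Lp_vec (M \<Otimes>\<^sub>M lborel) p"
  shows
    "(two_scale_weak M T p u U \<longrightarrow>
        Liminf (at_right 0) (\<lambda>\<epsilon>. ereal (\<integral>\<omega>. (LINT x:(Qp \<epsilon> \<inter> scaled_lattice \<epsilon>)|lattice_measure \<epsilon>.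
            V (T (x /\<^sub>R \<epsilon>) \<omega>) (u \<epsilon> (\<omega>, x))) \<partial>M))
          \<ge> ereal (\<integral>\<omega>. (LINT x:Q|lborel. V \<omega> (U (\<omega>, x))) \<partial>M)) \<and>
     (two_scale_strong M T p u U \<longrightarrow>
        ((\<lambda>\<epsilon>. \<integral>\<omega>. (LINT x:(Qp \<epsilon> \<inter> scaled_lattice \<epsilon>)|lattice_measure \<epsilon>.
            V (T (x /\<^sub>R \<epsilon>) \<omega>) (u \<epsilon> (\<omega>, x))) \<partial>M)
          \<longlongrightarrow> (\<integral>\<omega>. (LINT x:Q|lborel. V \<omega> (U (\<omega>, x))) \<partial>M)) (at_right 0))"
proof -
  interpret M: prob_space M by fact
  have "\<exists>C>0. AE \<omega> in M. \<forall>F. 1 / C * norm F powr p - C \<le> V \<omega> F \<and> V \<omega> F \<le> C * (norm F powr p + 1)"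
    by fact
  then obtain C where C: "C > 0"
    and growth: "AE \<omega> in M. \<forall>F. 1 / C * norm F powr p - C \<le> V \<omega> F \<and> V \<omega> F \<le> C * (norm F powr p + 1)"
    by blast
  have VM: "convex_integrand M V p C"
    by (rule convex_integrand.intro) fact+
  define N where "N = M \<Otimes>\<^sub>M (lborel :: (real ^ 'd) measure)"
  have VN: "convex_integrand N (\<lambda>z. V (fst z)) p C"
    unfolding N_def by (rule convex_integrand_fst[OF VM lborel.sigma_finite_measure_axioms])
  interpret V: convex_integrand N "\<lambda>z. V (fst z)" p C by (rule VN)
  interpret P: pair_sigma_finite M "lborel :: (real ^ 'd) measure"
    by (rule pair_sigma_finite.intro) (rule M.sigma_finite_measure_axioms lborel.sigma_finite_measure_axioms)+
  have Q: "open Q" "bounded Q" "Q \<noteq> {}" "lipschitz_boundary Q"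
    using \<open>bounded_lipschitz_domain Q\<close> unfolding bounded_lipschitz_domain_def by blast+
  have "\<exists>C>0. \<forall>\<epsilon>>0. Q \<subseteq> Qp \<epsilon> \<and> Qp \<epsilon> \<subseteq> {x. infdist x Q \<le> C * \<epsilon>}" by fact
  then obtain c where c: "c > 0" and Qp: "\<And>\<epsilon>. \<epsilon> > 0 \<Longrightarrow> Q \<subseteq> Qp \<epsilon>" "\<And>\<epsilon>. \<epsilon> > 0 \<Longrightarrow> Qp \<epsilon> \<subseteq> {x. infdist x Q \<le> c * \<epsilon>}"
    by blast
  have Qp_bounded: "bounded (Qp \<epsilon>)" if "\<epsilon> > 0" for \<epsilon>
    using bounded_subset[OF bounded_infdist_le[OF Q(2,3)] Qp(2)[OF that]] .
  have U: "U \<in> Lp_vec N p" unfolding N_def by fact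

  define A where "A \<epsilon> = space M \<times> {y. lattice_floor \<epsilon> y \<in> Qp \<epsilon>}" for \<epsilon>
  define X where "X = space M \<times> Q"
  \<comment> \<open>One set of finite measure around all \<open>A \<epsilon>\<close> with \<open>\<epsilon> < 1\<close>, for dominated convergence.\<close>
  define B where "B = space M \<times> {y. infdist y Q \<le> c + real CARD('d)}"
  define W where "W \<epsilon> = unfolding_op T \<epsilon> (u \<epsilon>)" for \<epsilon>
  define I where "I \<epsilon> = (\<integral>z. indicator (A \<epsilon>) z * V (fst z) (W \<epsilon> z) \<partial>N)" for \<epsilon>
  define J where "J = (\<integral>z. indicator X z * V (fst z) (U z) \<partial>N)"

  have times: "space M \<times> Y \<in> sets N" if "Y \<in> sets lborel" for Y :: "(real ^ 'd) set"
    unfolding N_def by (rule pair_measureI[OF sets.top that])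
  have emeas: "emeasure N (space M \<times> Y) = emeasure lborel Y" if "Y \<in> sets lborel" for Y :: "(real ^ 'd) set"
    unfolding N_def using that by (simp add: lborel.emeasure_pair_measure_Times M.emeasure_space_1)
  have "closed {y. infdist y Q \<le> c + real CARD('d)}"
    by (intro closed_Collect_le continuous_on_const continuous_on_infdist continuous_on_id)
  then have Bl: "{y. infdist y Q \<le> c + real CARD('d)} \<in> sets lborel" by simp
  have B: "B \<in> sets N" "emeasure N B < \<infinity>"
    unfolding B_def by (rule times[OF Bl]) (simp only: emeas[OF Bl] emeasure_bounded_finite[OF bounded_infdist_le[OF Q(2,3)]])
  have Ql: "Q \<in> sets lborel" using Q(1) by simp
  have X: "X \<in> sets N" "X \<subseteq> B"
  proof -
    show "X \<in> sets N" unfolding X_def by (rule times[OF Ql])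
    show "X \<subseteq> B" unfolding X_def B_def using c by auto
  qed
  have A: "A \<epsilon> \<in> sets N" "A \<epsilon> \<subseteq> B" if e: "0 < \<epsilon>" "\<epsilon> < 1" for \<epsilon>
  proof -
    show "A \<epsilon> \<in> sets N" unfolding A_def by (rule times[OF sampled_set_measurable[OF e(1) Qp_bounded[OF e(1)]]])
    have "infdist y Q \<le> c + real CARD('d)" if y: "lattice_floor \<epsilon> y \<in> Qp \<epsilon>" for y
    proof -
      have "infdist y Q \<le> (c + real CARD('d)) * \<epsilon>" by (rule infdist_sampled_le[OF e(1) Qp(2)[OF e(1)] y])
      also have "\<dots> \<le> (c + real CARD('d)) * 1" using c e by (intro mult_left_mono) auto
      finally show ?thesis by simp
    qed
    then show "A \<epsilon> \<subseteq> B" unfolding A_def B_def by blast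
  qed
  have fin: "emeasure N Y < \<infinity>" if "Y \<subseteq> B" for Y
    by (rule le_less_trans[OF emeasure_mono[OF that B(1)] B(2)])
  have "AE y in lborel. y \<notin> frontier Q"
    using AE_not_in[OF lipschitz_boundary_null[OF Q(1,4)]] .
  then have "AE z in N. snd z \<notin> frontier Q"
    unfolding N_def by (rule AE_snd_pair[OF lborel.sigma_finite_measure_axioms])
  then have ev: "AE z in N. \<forall>\<^sub>F \<epsilon> in at_right 0. (z \<in> A \<epsilon> \<longleftrightarrow> z \<in> X)"
  proof eventually_elim
    case (elim z)
    have "\<forall>\<^sub>F \<epsilon> in at_right 0. lattice_floor \<epsilon> (snd z) \<in> Qp \<epsilon> \<longleftrightarrow> snd z \<in> Q"
      by (rule sampled_set_eventually_iff[OF Q(1,3) elim Qp])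
    then show ?case
      by eventually_elim (auto simp: A_def X_def mem_Times_iff)
  qed
  have lim: "((\<lambda>\<epsilon>. \<integral>z. indicator (A \<epsilon>) z * h z \<partial>N) \<longlongrightarrow> (\<integral>z. indicator X z * h z \<partial>N)) (at_right 0)"
    if "integrable N (\<lambda>z. indicator B z * h z)" for h :: "'w \<times> (real ^ 'd) \<Rightarrow> real"
    by (rule integral_indicator_tendsto_at_right[OF that A X ev])
  have "integrable N (\<lambda>z. indicator B z * (1 :: real))" using B by simp
  from lim[OF this] have \<mu>A': "((\<lambda>\<epsilon>. measure N (A \<epsilon> \<inter> space N)) \<longlongrightarrow> measure N (X \<inter> space N)) (at_right 0)"
    by simp
  have \<mu>A: "((\<lambda>\<epsilon>. measure N (A \<epsilon>)) \<longlongrightarrow> measure N X) (at_right 0)"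
  proof -
    have "A \<epsilon> \<inter> space N = A \<epsilon>" "X \<inter> space N = X" for \<epsilon>
      by (auto simp: A_def X_def N_def space_pair_measure)
    with \<mu>A' show ?thesis by simp
  qed
  have UA: "((\<lambda>\<epsilon>. \<integral>z. indicator (A \<epsilon>) z * V (fst z) (U z) \<partial>N) \<longlongrightarrow> J) (at_right 0)"
    unfolding J_def by (rule lim[OF V.integrable_superposition[OF U B]])

  have I: "(\<integral>\<omega>. (LINT x:(Qp \<epsilon> \<inter> scaled_lattice \<epsilon>)|lattice_measure \<epsilon>.
            V (T (x /\<^sub>R \<epsilon>) \<omega>) (u \<epsilon> (\<omega>, x))) \<partial>M) = I \<epsilon>" if e: "\<epsilon> > 0" for \<epsilon>
    unfolding I_def A_def W_def N_def
    by (rule energy_unfolding[OF assms(2,4) VM e Qp_bounded[OF e] assms(11)[rule_format, OF e]])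
  have J: "(\<integral>\<omega>. (LINT x:Q|lborel. V \<omega> (U (\<omega>, x))) \<partial>M) = J"
  proof -
    have "integrable (M \<Otimes>\<^sub>M lborel) (\<lambda>z. indicator X z * V (fst z) (U z))"
      using V.integrable_superposition[OF U X(1) fin[OF X(2)]] unfolding N_def .
    from P.integral_fst'[OF this] have "J = (\<integral>\<omega>. (\<integral>x. indicator X (\<omega>, x) * V \<omega> (U (\<omega>, x)) \<partial>lborel) \<partial>M)"
      unfolding J_def N_def by simp
    also have "\<dots> = (\<integral>\<omega>. (LINT x:Q|lborel. V \<omega> (U (\<omega>, x))) \<partial>M)"
      unfolding set_lebesgue_integral_def
      by (intro Bochner_Integration.integral_cong refl) (simp add: X_def indicator_def)
    finally show ?thesis by simp
  qed
  have pos: "\<forall>\<^sub>F \<epsilon> in at_right (0 :: real). \<epsilon> > 0" by (rule eventually_at_right_less)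

  have gt: "\<forall>\<^sub>F \<epsilon> in at_right 0. a < I \<epsilon>" if weak: "two_scale_weak M T p u U" and a: "a < J" for a
  proof -
    obtain K :: "nat \<Rightarrow> (real ^ 'd) set" where K: "\<And>m. K m \<in> sets lborel" "\<And>m. K m \<subseteq> Q"
      "\<And>y. y \<in> Q \<Longrightarrow> \<forall>\<^sub>F m in sequentially. y \<in> K m"
      "\<And>m. \<forall>\<^sub>F \<epsilon> in at_right 0. K m \<subseteq> {y. lattice_floor \<epsilon> y \<in> Qp \<epsilon>}"
      by (rule ex_interior_exhaustion[OF Q(1,2) Qp(1)]) (assumption, rule that)
    show ?thesis unfolding I_def
    proof (rule V.eventually_integral_superposition_gt[where K="\<lambda>m. space M \<times> K m", OF X(1) fin[OF X(2)] A(1) fin[OF A(2)] \<mu>A _ _ _ _ U])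
      show "space M \<times> K m \<in> sets N" for m by (rule times[OF K(1)])
      show "space M \<times> K m \<subseteq> X" for m unfolding X_def using K(2) by blast
      show "\<forall>\<^sub>F m in sequentially. z \<in> space M \<times> K m" if "z \<in> X" for z
      proof -
        have z: "fst z \<in> space M" "snd z \<in> Q" using that by (auto simp: X_def)
        show ?thesis using K(3)[OF z(2)] by eventually_elim (use z(1) in \<open>simp add: mem_Times_iff\<close>)
      qed
      show "\<forall>\<^sub>F \<epsilon> in at_right 0. space M \<times> K m \<subseteq> A \<epsilon>" for m
        using K(4)[of m] by eventually_elim (auto simp: A_def)
      show "Lp_weak_conv N p (\<lambda>\<epsilon> z. W \<epsilon> z $ i) (\<lambda>z. U z $ i)" for i
        using weak unfolding two_scale_weak_def N_def W_def by blast
      show "a < (\<integral>z. indicator X z * V (fst z) (U z) \<partial>N)" using a unfolding J_def .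
    qed
  qed
  have less: "\<forall>\<^sub>F \<epsilon> in at_right 0. I \<epsilon> < a" if strong: "two_scale_strong M T p u U" and a: "J < a" for a
    unfolding I_def
  proof (rule V.eventually_integral_superposition_less[OF A(1) fin[OF A(2)] \<mu>A UA U _ a])
    show "Lp_strong_conv N p (\<lambda>\<epsilon> z. W \<epsilon> z $ i) (\<lambda>z. U z $ i)" for i
      using strong unfolding two_scale_strong_def N_def W_def by blast
  qed
  have weakI: "two_scale_weak M T p u U" if "two_scale_strong M T p u U"
  proof -
    have p0: "p > 0" using V.p by simp
    show ?thesis
      unfolding two_scale_weak_def
    proof
      fix i
      show "Lp_weak_conv (M \<Otimes>\<^sub>M lborel) p (\<lambda>\<epsilon> z. unfolding_op T \<epsilon> (u \<epsilon>) z $ i) (\<lambda>z. U z $ i)"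
        using that[unfolded two_scale_strong_def, THEN spec, of i] p0 by (rule Lp_strong_imp_weak)
    qed
  qed

  let ?I = "\<lambda>\<epsilon>. \<integral>\<omega>. (LINT x:(Qp \<epsilon> \<inter> scaled_lattice \<epsilon>)|lattice_measure \<epsilon>.
            V (T (x /\<^sub>R \<epsilon>) \<omega>) (u \<epsilon> (\<omega>, x))) \<partial>M"
  have eqI: "\<forall>\<^sub>F \<epsilon> in at_right 0. ?I \<epsilon> = I \<epsilon>"
    using pos by eventually_elim (rule I)
  show ?thesis unfolding J
  proof (intro conjI impI)
    assume weak: "two_scale_weak M T p u U"
    show "ereal J \<le> Liminf (at_right 0) (\<lambda>\<epsilon>. ereal (?I \<epsilon>))"
      unfolding le_Liminf_iff
    proof (intro allI impI)
      fix y assume y: "y < ereal J"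
      show "\<forall>\<^sub>F \<epsilon> in at_right 0. y < ereal (?I \<epsilon>)"
      proof (cases y)
        case (real a)
        then have "a < J" using y by simp
        from gt[OF weak this] eqI show ?thesis by eventually_elim (simp add: real)
      qed (use y in auto)
    qed
  next
    assume strong: "two_scale_strong M T p u U"
    have "(I \<longlongrightarrow> J) (at_right 0)"
    proof (rule order_tendstoI)
      show "\<forall>\<^sub>F \<epsilon> in at_right 0. a < I \<epsilon>" if "a < J" for a by (rule gt[OF weakI[OF strong] that])
      show "\<forall>\<^sub>F \<epsilon> in at_right 0. I \<epsilon> < a" if "J < a" for a by (rule less[OF strong that])
    qed
    then show "(?I \<longlongrightarrow> J) (at_right 0)" by (rule tendsto_cong[OF eqI, THEN iffD2])
  qed
qed

end
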